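(* Let $d \geq 1$, let $S$ be a finite set with $0 \in S$, and let $X \subset S^{\mathbb{Z}^d}$ be a subshift of finite type in which the $0$-finite configurations belonging to $X$ are dense. If $c : X \to X$ is an asymptotically $0$-nilpotent cellular automaton, then $c$ is $0$-nilpotent.
   Context: $S^{\mathbb{Z}^d}$ carries the product topology of the discrete topology on the finite set $S$. For $v \in \mathbb{Z}^d$ the shift $\sigma^v$ is defined by $\sigma^v(x)_u = x_{u+v}$. A subshift is a topologically closed subset of $S^{\mathbb{Z}^d}$ that is invariant under $\sigma^v$ for all $v \in \mathbb{Z}^d$; equivalently, it is the set of configurations containing no translate of any pattern from some set of forbidden finite patterns. It is a subshift of finite type (SFT) if the set of forbidden patterns can be taken to be finite. A cellular automaton on $X$ is a continuous map $c : X \to X$ that commutes with $\sigma^v$ for all $v \in \mathbb{Z}^d$. $c^n$ denotes the $n$-fold iterate of $c$. A configuration $x \in S^{\mathbb{Z}^d}$ is $0$-finite if $\{v \in \mathbb{Z}^d : x_v \neq 0\}$ is finite. $c$ is $0$-nilpotent if there exists $m \in \mathbb{N}$ such that for all $n \geq m$, all $x \in X$ and all $v \in \mathbb{Z}^d$, $c^n(x)_v = 0$. $c$ is asymptotically $0$-nilpotent if for all $x \in X$ and all $v \in \mathbb{Z}^d$ there exists $m \in \mathbb{N}$ such that for all $n \geq m$, $c^n(x)_v = 0$. *)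

theory Defs
  imports "HOL-Analysis.Analysis"
begin

text \<open>
  The lattice of rank \<open>d\<close> is \<open>int ^ 'd\<close> with \<open>d = CARD('d)\<close>; types are nonempty, so
  \<open>d \<ge> 1\<close> holds automatically. The distinguished symbol of the alphabet is an arbitrary
  element \<open>z\<close>, which plays the role of \<open>0\<close>.
\<close>

type_synonym ('a, 'd) config = "int ^ 'd \<Rightarrow> 'a"

definition full_shift :: "'a set \<Rightarrow> ('a, 'd::finite) config topology" where
  "full_shift S = product_topology (\<lambda>_. discrete_topology S) UNIV"

definition shift :: "int ^ 'd \<Rightarrow> ('a, 'd::finite) config \<Rightarrow> ('a, 'd) config" where
  "shift v x = (\<lambda>u. x (u + v))"

definition subshift :: "'a set \<Rightarrow> ('a, 'd::finite) config set \<Rightarrow> bool" where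
  "subshift S X \<longleftrightarrow> closedin (full_shift S) X \<and> (\<forall>v. \<forall>x\<in>X. shift v x \<in> X)"

definition finite_pattern :: "'a set \<Rightarrow> (int ^ 'd::finite \<rightharpoonup> 'a) \<Rightarrow> bool" where
  "finite_pattern S p \<longleftrightarrow> finite (dom p) \<and> ran p \<subseteq> S"

definition contains_translate :: "('a, 'd::finite) config \<Rightarrow> (int ^ 'd \<rightharpoonup> 'a) \<Rightarrow> bool" where
  "contains_translate x p \<longleftrightarrow> (\<exists>v. \<forall>u\<in>dom p. p u = Some (x (u + v)))"

definition subshift_of_finite_type :: "'a set \<Rightarrow> ('a, 'd::finite) config set \<Rightarrow> bool" where
  "subshift_of_finite_type S X \<longleftrightarrow> subshift S X \<and>
    (\<exists>F. finite F \<and> (\<forall>p\<in>F. finite_pattern S p) \<and>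
      X = {x \<in> topspace (full_shift S). \<forall>p\<in>F. \<not> contains_translate x p})"

text \<open>
  The values of \<open>c\<close> outside \<open>X\<close> are irrelevant; continuity between the subspaces includes
  that \<open>c\<close> maps \<open>X\<close> into itself.
\<close>

definition cellular_automaton ::
    "'a set \<Rightarrow> ('a, 'd::finite) config set \<Rightarrow> (('a, 'd) config \<Rightarrow> ('a, 'd) config) \<Rightarrow> bool" where
  "cellular_automaton S X c \<longleftrightarrow>
    continuous_map (subtopology (full_shift S) X) (subtopology (full_shift S) X) c \<and>
    (\<forall>v. \<forall>x\<in>X. c (shift v x) = shift v (c x))"

definition finite_config :: "'a \<Rightarrow> ('a, 'd::finite) config \<Rightarrow> bool" where
  "finite_config z x \<longleftrightarrow> finite {v. x v \<noteq> z}"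

definition nilpotent_on ::
    "'a \<Rightarrow> ('a, 'd::finite) config set \<Rightarrow> (('a, 'd) config \<Rightarrow> ('a, 'd) config) \<Rightarrow> bool" where
  "nilpotent_on z X c \<longleftrightarrow> (\<exists>m. \<forall>n\<ge>m. \<forall>x\<in>X. \<forall>v. (c ^^ n) x v = z)"

definition asymptotically_nilpotent_on ::
    "'a \<Rightarrow> ('a, 'd::finite) config set \<Rightarrow> (('a, 'd) config \<Rightarrow> ('a, 'd) config) \<Rightarrow> bool" where
  "asymptotically_nilpotent_on z X c \<longleftrightarrow> (\<forall>x\<in>X. \<forall>v. \<exists>m. \<forall>n\<ge>m. (c ^^ n) x v = z)"

end

theory Submission
  imports Defs
begin

text \<open>
  Compactness of \<open>X\<close> and the finite type condition turn all hypotheses into statements with a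
  radius \<open>s\<close>: \<open>c\<close> reads windows of radius \<open>s\<close>, and a configuration that looks like members of
  \<open>X\<close> in every window of radius \<open>s\<close> lies in \<open>X\<close>. Hence far apart configurations of \<open>X\<close> can be
  superposed in \<open>X\<close>, and they do not interact before the signals of speed \<open>s\<close> meet.

  If every configuration had a perturbation far away that reaches a fixed window arbitrarily late,
  infinitely many such perturbations could be added one after another, and the limit would
  contradict asymptotic nilpotency. So each nonempty class of configurations has a member \<open>x\<close> and
  a box such that the members that agree with \<open>x\<close> on the box leave the window blank from a common
  time on (\<open>locked_window\<close>). If that \<open>x\<close> is mortal, that is, eventually blank everywhere, then
  superposing \<open>x\<close> and a distant \<open>y\<close> shows that even an empty box is enough to keep \<open>y\<close> away: after
  the death of \<open>x\<close> only \<open>y\<close> remains (\<open>empty_tube_shields\<close>). For the finite configurations this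
  says that a large empty box makes its centre blank from a fixed time \<open>N\<close> on; by density it holds
  in all of \<open>X\<close>, and since by compactness each orbit has such a box before a uniform time,
  \<open>c\<close> is nilpotent.

  It remains to see that finite configurations are mortal. This is proved for all ``crystals'',
  configurations that are periodic in a set \<open>K\<close> of coordinate directions and bounded in the others,
  by induction on the number of free directions. Without free directions there are finitely many
  cells up to periods. With two or more free directions, repeat a crystal periodically in a free
  direction \<open>i\<close>: by induction the crystals with the additional direction \<open>i\<close> are mortal, so empty
  tubes along \<open>i\<close> are blank on their axis after a fixed time, and no crystal can spread
  orthogonally to \<open>i\<close>. Using a second free direction, it cannot spread at all, and a confined
  crystal dies because up to periods it lives on finitely many cells.

  With a single free direction there is no second one to use, but slabs separate space. A locked
  slab provides a word \<open>y\<close> that creates a permanently blank wall. Suppose that \<open>x\<close> is immortal. Its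
  activity escapes to infinity, so translates of \<open>x\<close> that start far away hit the origin late. Put
  walls on the far left and the far right of such a translate and erase everything outside of the
  walls: the result is confined, hence mortal, and still hits the origin late. So late
  hits by mortal crystals that start far away can be added to any mortal crystal, which
  contradicts \<open>locked_window\<close> for the class of mortal crystals.
\<close>

section \<open>Boxes, shifts and periods\<close>

definition near :: "int \<Rightarrow> int ^ 'd::finite \<Rightarrow> int ^ 'd \<Rightarrow> bool" where
  "near b u v \<longleftrightarrow> (\<forall>i. \<bar>u $ i - v $ i\<bar> \<le> b)"

lemma near_triangle: "near a u v \<Longrightarrow> near b v w \<Longrightarrow> near (a + b) u w"
  unfolding near_def
proof
  fix i assume "\<forall>i. \<bar>u $ i - v $ i\<bar> \<le> a" "\<forall>i. \<bar>v $ i - w $ i\<bar> \<le> b"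
  then have "\<bar>u $ i - v $ i\<bar> \<le> a" "\<bar>v $ i - w $ i\<bar> \<le> b" by auto
  then show "\<bar>u $ i - w $ i\<bar> \<le> a + b" by linarith
qed

lemma near_mono: "near a u v \<Longrightarrow> a \<le> b \<Longrightarrow> near b u v"
  unfolding near_def by (meson order_trans)

lemma near_commute: "near a u v \<longleftrightarrow> near a v u"
  unfolding near_def by (simp add: abs_minus_commute)

lemma ex_near: "\<exists>b\<ge>0. near b u 0"
proof (intro exI conjI)
  show "near (\<Sum>i\<in>UNIV. \<bar>u $ i\<bar>) u 0"
    unfolding near_def by (auto intro!: member_le_sum)
qed (simp add: sum_nonneg)

lemma finite_near: "finite {u :: int ^ 'd::finite. near b u 0}"
proof (rule finite_subset)
  show "{u :: int ^ 'd. near b u 0} \<subseteq> vec_lambda ` (UNIV \<rightarrow>\<^sub>E {- b..b})"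
  proof
    fix u :: "int ^ 'd" assume "u \<in> {u. near b u 0}"
    then have "u = vec_lambda (\<lambda>i. u $ i)" "(\<lambda>i. u $ i) \<in> UNIV \<rightarrow>\<^sub>E {- b..b}"
      unfolding near_def by (auto simp: abs_le_iff) (metis minus_le_iff)
    then show "u \<in> vec_lambda ` (UNIV \<rightarrow>\<^sub>E {- b..b})" by blast
  qed
  show "finite (vec_lambda ` (UNIV \<rightarrow>\<^sub>E {- b..b}) :: (int ^ 'd) set)"
    by (intro finite_imageI finite_PiE) auto
qed

lemma shift_shift: "shift v (shift w x) = shift (v + w) x"
  by (simp add: shift_def add.assoc)

lemma shift_zero: "shift 0 x = x"
  by (simp add: shift_def)

definition periodic :: "'d set \<Rightarrow> int \<Rightarrow> ('a, 'd::finite) config \<Rightarrow> bool" where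
  "periodic K q x \<longleftrightarrow> (\<forall>i\<in>K. shift (axis i q) x = x)"

lemma periodic_mult:
  fixes x :: "('a, 'd::finite) config"
  assumes "periodic K q x"
  shows "periodic K (q * k) x"
  unfolding periodic_def
proof
  fix i assume i: "i \<in> K"
  have step: "axis i (q * (j + l)) = axis i (q * j) + axis i (q * l)" for j l
    by (simp add: vec_eq_iff axis_def distrib_left)
  have 1: "shift (axis i q) x = x"
    using assms i by (simp add: periodic_def)
  have m1: "shift (axis i (- q)) x = x"
  proof -
    have "shift (axis i (- q)) (shift (axis i q) x) = shift (axis i (- q) + axis i q) x"
      by (rule shift_shift)
    also have "axis i (- q) + axis i q = 0" by (simp add: vec_eq_iff axis_def)
    finally show ?thesis using 1 by (simp add: shift_zero)
  qed
  show "shift (axis i (q * k)) x = x"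
  proof (induction k rule: int_induct[where k = 0])
    case base
    have "axis i (q * 0) = (0 :: int ^ 'd)" by (simp add: vec_eq_iff axis_def)
    then show ?case by (simp only: shift_zero)
  next
    case (step1 j)
    then have "shift (axis i (q * j)) (shift (axis i q) x) = x" using 1 by simp
    then show ?case using step[of j 1] by (simp add: shift_shift)
  next
    case (step2 j)
    then have "shift (axis i (q * j)) (shift (axis i (- q)) x) = x" using m1 by simp
    then show ?case using step[of j "- 1"] by (simp add: shift_shift)
  qed
qed

text \<open>
  Up to periods a bounded tube consists of finitely many cells; this is how asymptotic nilpotency,
  a statement about single cells, becomes uniform on tubes.
\<close>

lemma periodic_reduce:
  fixes x :: "('a, 'd::finite) config"
  assumes "periodic K q x"
  shows "x u = x (\<chi> i. if i \<in> K then u $ i mod q else u $ i)"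
proof -
  have "finite K" by simp
  then show ?thesis using assms
  proof (induction K)
    case empty
    then show ?case by simp
  next
    case (insert i K)
    let ?w = "\<chi> j. if j \<in> K then u $ j mod q else u $ j"
    let ?w' = "\<chi> j. if j \<in> insert i K then u $ j mod q else u $ j"
    have w: "?w = ?w' + axis i (q * (u $ i div q))"
      using insert.hyps by (auto simp: vec_eq_iff axis_def)
    have "shift (axis i (q * (u $ i div q))) x = x"
      using periodic_mult[OF insert.prems] by (simp add: periodic_def)
    then have "shift (axis i (q * (u $ i div q))) x ?w' = x ?w'" by (rule arg_cong)
    then have "x ?w = x ?w'" unfolding w by (simp only: shift_def)
    moreover have "periodic K q x" using insert.prems by (simp add: periodic_def)
    then have "x u = x ?w" by (rule insert.IH)
    ultimately show ?case by (simp only:)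
  qed
qed

definition overlay :: "'a \<Rightarrow> ('a, 'd::finite) config \<Rightarrow> ('a, 'd) config \<Rightarrow> ('a, 'd) config" where
  "overlay z x x' = (\<lambda>u. if x u = z then x' u else x u)"

definition supported_in_tube :: "'a \<Rightarrow> 'd set \<Rightarrow> int \<Rightarrow> ('a, 'd::finite) config \<Rightarrow> bool" where
  "supported_in_tube z K b x \<longleftrightarrow> (\<forall>u. x u \<noteq> z \<longrightarrow> (\<forall>j. j \<notin> K \<longrightarrow> \<bar>u $ j\<bar> \<le> b))"

lemma supported_in_tube_mono: "supported_in_tube z K b x \<Longrightarrow> b \<le> b' \<Longrightarrow> supported_in_tube z K b' x"
  unfolding supported_in_tube_def by (meson order_trans)

section \<open>Dynamics with a radius\<close>

text \<open>
  Closedness and finite type enter only through \<open>glue\<close>, continuity only through \<open>step_local\<close>.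
  One common radius serves both purposes.
\<close>

locale local_dynamics =
  fixes z :: 'a
    and X :: "('a, 'd::finite) config set"
    and c :: "('a, 'd) config \<Rightarrow> ('a, 'd) config"
    and s :: int
  assumes radius_nonneg: "0 \<le> s"
    and nonempty: "X \<noteq> {}"
    and glue: "(\<And>v. \<exists>x'\<in>X. \<forall>u. near s u v \<longrightarrow> x u = x' u) \<Longrightarrow> x \<in> X"
    and shift_mem: "x \<in> X \<Longrightarrow> shift v x \<in> X"
    and step_mem: "x \<in> X \<Longrightarrow> c x \<in> X"
    and step_local: "x \<in> X \<Longrightarrow> x' \<in> X \<Longrightarrow> (\<And>u. near s u v \<Longrightarrow> x u = x' u) \<Longrightarrow> c x v = c x' v"
    and step_shift: "x \<in> X \<Longrightarrow> c (shift v x) = shift v (c x)"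
    and vanishing: "x \<in> X \<Longrightarrow> \<exists>m. \<forall>n\<ge>m. (c ^^ n) x v = z"
begin

abbreviation blank :: "('a, 'd) config" where
  "blank \<equiv> \<lambda>_. z"

definition mortal :: "('a, 'd) config \<Rightarrow> bool" where
  "mortal x \<longleftrightarrow> (\<exists>n. (c ^^ n) x = blank)"

definition crystal :: "'d set \<Rightarrow> int \<Rightarrow> ('a, 'd) config set" where
  "crystal K q = {x \<in> X. periodic K q x \<and> (\<exists>b. supported_in_tube z K b x)}"

lemma iterate_mem: "x \<in> X \<Longrightarrow> (c ^^ n) x \<in> X"
  by (induction n) (auto intro: step_mem)

lemma iterate_shift: "x \<in> X \<Longrightarrow> (c ^^ n) (shift v x) = shift v ((c ^^ n) x)"
  by (induction n) (auto simp: step_shift iterate_mem)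

lemma iterate_shift_apply: "x \<in> X \<Longrightarrow> (c ^^ n) (shift v x) u = (c ^^ n) x (u + v)"
  unfolding iterate_shift by (simp add: shift_def)

lemma iterate_local:
  assumes "x \<in> X" "x' \<in> X"
  shows "(\<And>u. near (int n * s) u v \<Longrightarrow> x u = x' u) \<Longrightarrow> (c ^^ n) x v = (c ^^ n) x' v"
proof (induction n arbitrary: v)
  case 0
  then show ?case by (simp add: near_def)
next
  case (Suc n)
  have "c ((c ^^ n) x) v = c ((c ^^ n) x') v"
  proof (rule step_local)
    fix u assume u: "near s u v"
    show "(c ^^ n) x u = (c ^^ n) x' u"
    proof (rule Suc.IH)
      fix w assume "near (int n * s) w u"
      then have "near (int (Suc n) * s) w v"
        using near_triangle[OF _ u] by (force simp: algebra_simps)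
      then show "x w = x' w" by (rule Suc.prems)
    qed
  qed (simp_all add: assms iterate_mem)
  then show ?case by simp
qed

lemma finite_vanishing:
  assumes "x \<in> X" "finite W"
  obtains m where "\<And>n w. m \<le> n \<Longrightarrow> w \<in> W \<Longrightarrow> (c ^^ n) x w = z"
proof -
  obtain f where f: "\<And>v n. f v \<le> n \<Longrightarrow> (c ^^ n) x v = z"
    using vanishing[OF assms(1)] by metis
  have "\<exists>m. \<forall>w\<in>W. f w \<le> m"
    using assms(2) by (intro exI[of _ "Max (f ` W)"]) simp
  then obtain m where "\<forall>w\<in>W. f w \<le> m" ..
  with f show thesis by (intro that[of m]) (meson order_trans)
qed

text \<open>
  A window that the orbit of any \<open>x\<close> has left blank for two consecutive steps shows that the
  blank configuration is locally admissible and locally fixed; translating the window does it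
  everywhere.
\<close>

lemma blank_mem: "blank \<in> X"
  and step_blank: "c blank = blank"
proof -
  obtain x where x: "x \<in> X" using nonempty by blast
  obtain m where m: "\<And>n w. m \<le> n \<Longrightarrow> w \<in> {u. near s u 0} \<Longrightarrow> (c ^^ n) x w = z"
    using finite_vanishing[OF x finite_near] by blast
  define y where "y = (c ^^ m) x"
  have y: "y \<in> X" and y0: "\<And>u. near s u 0 \<Longrightarrow> y u = z"
    using m x by (auto simp: y_def iterate_mem)
  have loc: "shift (- v) y u = z" if "near s u v" for u v
    using y0[of "u - v"] that by (simp add: shift_def near_def)
  show mem: "blank \<in> X"
    by (rule glue) (metis loc shift_mem y)
  have "c y 0 = z"
    using m[of "Suc m" 0] radius_nonneg by (simp add: y_def near_def)
  then have "shift (- v) (c y) v = z" for v by (simp add: shift_def)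
  moreover have "c blank v = c (shift (- v) y) v" for v
    by (rule step_local) (auto simp: mem loc shift_mem y)
  ultimately show "c blank = blank" by (simp add: step_shift y fun_eq_iff)
qed

lemma iterate_blank: "(c ^^ n) blank = blank"
  by (induction n) (auto simp: step_blank)

lemma dead_stays_dead:
  assumes "(c ^^ m) x = blank" "m \<le> n"
  shows "(c ^^ n) x = blank"
proof -
  have "(c ^^ n) x = (c ^^ (n - m)) ((c ^^ m) x)"
    using assms(2) by (metis funpow_add comp_apply le_add_diff_inverse2)
  then show ?thesis using assms(1) iterate_blank by simp
qed

lemma iterate_periodic:
  assumes "x \<in> X" "periodic K q x"
  shows "periodic K q ((c ^^ n) x)"
  using assms(2) iterate_shift[OF assms(1), symmetric] by (simp add: periodic_def)

lemma iterate_supported_in_tube: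
  assumes x: "x \<in> X" and b: "supported_in_tube z K b x"
  shows "supported_in_tube z K (b + int n * s) ((c ^^ n) x)"
  unfolding supported_in_tube_def
proof (intro allI impI, rule ccontr)
  fix u j assume nz: "(c ^^ n) x u \<noteq> z" and j: "j \<notin> K" "\<not> \<bar>u $ j\<bar> \<le> b + int n * s"
  have "(c ^^ n) x u = (c ^^ n) blank u"
  proof (rule iterate_local[OF x blank_mem])
    fix w assume "near (int n * s) w u"
    then have "\<bar>w $ j - u $ j\<bar> \<le> int n * s" by (simp add: near_def)
    with j(2) have "\<not> \<bar>w $ j\<bar> \<le> b" by linarith
    then show "x w = z" using b j(1) unfolding supported_in_tube_def by blast
  qed
  with nz show False by (simp add: iterate_blank)
qed

lemma blank_crystal: "blank \<in> crystal K q"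
  by (simp add: crystal_def blank_mem periodic_def shift_def supported_in_tube_def)

lemma iterate_crystal: "x \<in> crystal K q \<Longrightarrow> (c ^^ n) x \<in> crystal K q"
  unfolding crystal_def by (auto simp: iterate_mem iterate_periodic dest: iterate_supported_in_tube)

lemma shift_crystal:
  assumes "x \<in> crystal K q"
  shows "shift v x \<in> crystal K q"
proof -
  obtain b where b: "supported_in_tube z K b x" using assms by (auto simp: crystal_def)
  obtain r where r: "near r v 0" using ex_near by blast
  have "supported_in_tube z K (b + r) (shift v x)"
    unfolding supported_in_tube_def
  proof (intro allI impI)
    fix u j assume "shift v x u \<noteq> z" "j \<notin> K"
    then have "\<bar>(u + v) $ j\<bar> \<le> b" using b by (auto simp: supported_in_tube_def shift_def)
    moreover have "\<bar>v $ j\<bar> \<le> r" using r by (simp add: near_def)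
    ultimately show "\<bar>u $ j\<bar> \<le> b + r" by simp
  qed
  moreover have "periodic K q (shift v x)"
    unfolding periodic_def
  proof
    fix i assume "i \<in> K"
    then have "shift (axis i q) x = x"
      using assms by (simp add: crystal_def periodic_def)
    moreover have "shift (axis i q) (shift v x) = shift v (shift (axis i q) x)"
      by (simp add: shift_shift add.commute)
    ultimately show "shift (axis i q) (shift v x) = shift v x" by simp
  qed
  ultimately show ?thesis
    using assms shift_mem by (auto simp: crystal_def)
qed

lemma tube_vanishing:
  assumes x: "x \<in> X" "periodic K q x" and q: "0 < q"
  obtains m where "\<And>n u. m \<le> n \<Longrightarrow> (\<And>j. j \<notin> K \<Longrightarrow> \<bar>u $ j\<bar> \<le> b) \<Longrightarrow> (c ^^ n) x u = z"
proof -
  obtain m where m: "\<And>n w. m \<le> n \<Longrightarrow> w \<in> {u. near (max q b) u 0} \<Longrightarrow> (c ^^ n) x w = z"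
    using finite_vanishing[OF x(1) finite_near] by blast
  show thesis
  proof (rule that[of m])
    fix n u assume n: "m \<le> n" and u: "\<And>j. j \<notin> K \<Longrightarrow> \<bar>u $ j\<bar> \<le> b"
    let ?w = "\<chi> i. if i \<in> K then u $ i mod q else u $ i"
    have "\<bar>?w $ i\<bar> \<le> max q b" for i
      using q u[of i] pos_mod_bound[OF q, of "u $ i"] pos_mod_sign[OF q, of "u $ i"]
      by (cases "i \<in> K") (simp_all add: abs_of_nonneg le_max_iff_disj)
    then have "near (max q b) ?w 0" by (simp add: near_def)
    then have "(c ^^ n) x ?w = z" using m[OF n] by simp
    then show "(c ^^ n) x u = z"
      using periodic_reduce[OF iterate_periodic[OF x], of n u] by simp
  qed
qed

text \<open>Only finitely many cells modulo periods are ever active, and each of them falls silent.\<close>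

lemma confined_mortal:
  assumes x: "x \<in> X" "periodic K q x" and q: "0 < q"
    and b: "\<And>n. N \<le> n \<Longrightarrow> supported_in_tube z K b ((c ^^ n) x)"
  shows "mortal x"
proof -
  obtain m where m: "\<And>n u. m \<le> n \<Longrightarrow> (\<And>j. j \<notin> K \<Longrightarrow> \<bar>u $ j\<bar> \<le> b) \<Longrightarrow> (c ^^ n) x u = z"
    using tube_vanishing[OF assms(1-3)] by blast
  have "(c ^^ max m N) x u = z" for u
    using m[of "max m N" u] b[of "max m N"] unfolding supported_in_tube_def by force
  then show ?thesis unfolding mortal_def by blast
qed

section \<open>Locked windows and superposition\<close>

text \<open>
  A Baire category argument. Otherwise each member of
  \<open>C\<close> could be changed far away so that it hits \<open>W\<close> at an arbitrarily late time. Iterating this,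
  with boxes growing so fast that later changes do not affect the hits already obtained, leads
  to a limit in \<open>X\<close> that hits the finite set \<open>W\<close> infinitely often.
\<close>

lemma locked_window:
  assumes C: "C \<subseteq> X" "C \<noteq> {}" and W: "finite W"
  obtains x b m where "x \<in> C"
    and "\<And>y n w. y \<in> C \<Longrightarrow> (\<And>u. near b u 0 \<Longrightarrow> y u = x u) \<Longrightarrow> m \<le> n \<Longrightarrow> w \<in> W
      \<Longrightarrow> (c ^^ n) y w = z"
proof (rule ccontr)
  note found = that
  assume "\<not> thesis"
  then have neg: "\<exists>y n w. y \<in> C \<and> (\<forall>u. near b u 0 \<longrightarrow> y u = x u) \<and> m \<le> n \<and> w \<in> W
      \<and> (c ^^ n) y w \<noteq> z" if "x \<in> C" for x b m
    using found[OF that, of b m] by blast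
  let ?P = "\<lambda>k :: nat. \<lambda>(x, b :: int, m :: nat). x \<in> C \<and> int k \<le> b"
  let ?Q = "\<lambda>k :: nat. \<lambda>(x, b, m :: nat) (x', b', m').
    (\<forall>u. near b u 0 \<longrightarrow> x' u = x u) \<and> b \<le> b' \<and> k \<le> m' \<and>
    (\<exists>w\<in>W. \<forall>y\<in>X. (\<forall>u. near b' u 0 \<longrightarrow> y u = x' u) \<longrightarrow> (c ^^ m') y w \<noteq> z)"
  have "\<exists>f. \<forall>k. ?P k (f k) \<and> ?Q k (f k) (f (Suc k))"
  proof (rule dependent_nat_choice)
    obtain x where "x \<in> C" using C by blast
    then show "\<exists>p. ?P 0 p" by (intro exI[of _ "(x, 0, 0)"]) simp
  next
    fix p k assume P: "?P k p"
    obtain x b m where p: "p = (x, b, m)" by (cases p)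
    obtain y n w where y: "y \<in> C" "\<And>u. near b u 0 \<Longrightarrow> y u = x u" "k \<le> n" "w \<in> W"
        "(c ^^ n) y w \<noteq> z"
      using neg[of x b k] P p by auto
    obtain r where r: "near r w 0" using ex_near by blast
    \<comment> \<open>The new box is large enough to determine the hit at time \<open>n\<close>, and boxes exhaust the lattice.\<close>
    define b' where "b' = max (int (Suc k)) (max b (int n * s + r))"
    have "(c ^^ n) y' w \<noteq> z" if "y' \<in> X" "\<forall>u. near b' u 0 \<longrightarrow> y' u = y u" for y'
    proof -
      have "(c ^^ n) y' w = (c ^^ n) y w"
      proof (rule iterate_local)
        fix u assume "near (int n * s) u w"
        then have "near b' u 0" using near_triangle[OF _ r] near_mono unfolding b'_def
          by (metis max.cobounded2 max.coboundedI2)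
        with that show "y' u = y u" by blast
      qed (use that y C in auto)
      with y show ?thesis by simp
    qed
    with y have "?P (Suc k) (y, b', n) \<and> ?Q k p (y, b', n)"
      by (auto simp: p b'_def)
    then show "\<exists>p'. ?P (Suc k) p' \<and> ?Q k p p'" by blast
  qed
  then obtain f where "\<forall>k. ?P k (f k) \<and> ?Q k (f k) (f (Suc k))" by (rule exE)
  then have f: "?P k (f k)" "?Q k (f k) (f (Suc k))" for k by (simp_all only:)
  define X' B M where "X' k = fst (f k)" and "B k = fst (snd (f k))" and "M k = snd (snd (f k))" for k
  have fk: "f k = (X' k, B k, M k)" for k by (simp add: X'_def B_def M_def)
  have mem: "X' k \<in> C" and large: "int k \<le> B k" for k
    using f(1)[of k] by (simp_all add: fk)
  have agree: "near (B k) u 0 \<Longrightarrow> X' (Suc k) u = X' k u" and inc: "B k \<le> B (Suc k)"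
    and late: "k \<le> M (Suc k)"
    and hit: "\<exists>w\<in>W. \<forall>y\<in>X. (\<forall>u. near (B (Suc k)) u 0 \<longrightarrow> y u = X' (Suc k) u)
      \<longrightarrow> (c ^^ M (Suc k)) y w \<noteq> z" for k u
    using f(2)[of k] by (simp_all add: fk)
  have agree': "X' j u = X' k u" if "near (B k) u 0" "k \<le> j" for j k u
    using that(2)
  proof (induction rule: dec_induct)
    case (step n)
    have "B k \<le> B n" using inc step.hyps(1) by (rule lift_Suc_mono_le)
    with step show ?case using agree near_mono that(1) by metis
  qed simp
  define x where "x u = X' (LEAST k. near (B k) u 0) u" for u
  have x: "x u = X' k u" if "near (B k) u 0" for u k
    unfolding x_def using agree'[of "LEAST k. near (B k) u 0" u k]
      LeastI[of "\<lambda>k. near (B k) u 0", OF that] Least_le[of "\<lambda>k. near (B k) u 0", OF that]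
    by simp
  have xX: "x \<in> X"
  proof (rule glue)
    fix v :: "int ^ 'd"
    obtain r where r: "near r v 0" using ex_near by blast
    obtain k :: nat where k: "s + r \<le> int k"
      using zle_int by (metis nat_le_iff order_refl)
    have "x u = X' k u" if "near s u v" for u
      using x near_mono[OF near_triangle[OF that r]] k large[of k] by (meson order_trans)
    then show "\<exists>x'\<in>X. \<forall>u. near s u v \<longrightarrow> x u = x' u" using mem C by blast
  qed
  obtain m where m: "\<And>n w. m \<le> n \<Longrightarrow> w \<in> W \<Longrightarrow> (c ^^ n) x w = z"
    using finite_vanishing[OF xX W] by blast
  obtain w where "w \<in> W" "(c ^^ M (Suc m)) x w \<noteq> z"
    using hit[of m] xX x by blast
  with m late show False by blast
qed

lemma overlay_mem:
  assumes x: "x \<in> X" "x' \<in> X"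
    and far: "\<And>u u'. x u \<noteq> z \<Longrightarrow> x' u' \<noteq> z \<Longrightarrow> \<not> near (2 * s) u u'"
  shows "overlay z x x' \<in> X"
proof (rule glue)
  fix v
  show "\<exists>y\<in>X. \<forall>u. near s u v \<longrightarrow> overlay z x x' u = y u"
  proof (cases "\<exists>u. near s u v \<and> x u \<noteq> z")
    case True
    then obtain u where u: "near s u v" "x u \<noteq> z" by blast
    have "overlay z x x' w = x w" if "near s w v" for w
    proof -
      have "near (2 * s) u w"
        using near_triangle[OF u(1), of s w] that by (simp add: near_commute)
      then show ?thesis using far[OF u(2), of w] by (auto simp: overlay_def)
    qed
    then show ?thesis using x by blast
  next
    case False
    then have "overlay z x x' w = x' w" if "near s w v" for w
      using that by (auto simp: overlay_def)
    then show ?thesis using x by blast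
  qed
qed

text \<open>
  Up to time \<open>T\<close> every cell is reached by signals from at most one of the two configurations, so
  at time \<open>T\<close> the first has vanished and left the second as it would be on its own.
\<close>

lemma overlay_dead:
  assumes x: "x \<in> X" "x' \<in> X"
    and far: "\<And>u u'. x u \<noteq> z \<Longrightarrow> x' u' \<noteq> z \<Longrightarrow> \<not> near (2 * s * int (Suc T)) u u'"
    and dead: "(c ^^ T) x = blank"
  shows "overlay z x x' \<in> X" and "T \<le> n \<Longrightarrow> (c ^^ n) (overlay z x x') = (c ^^ n) x'"
proof -
  have far': "\<not> near r u u'" if "x u \<noteq> z" "x' u' \<noteq> z" "r \<le> 2 * s * int (Suc T)" for u u' r
    using far[OF that(1,2)] that(3) near_mono by blast
  have "2 * s \<le> 2 * s * int (Suc T)"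
    using radius_nonneg by (simp add: algebra_simps)
  with far' show mem: "overlay z x x' \<in> X"
    by (intro overlay_mem x) blast
  have le: "2 * (int T * s) \<le> 2 * s * int (Suc T)"
    using radius_nonneg by (simp add: algebra_simps)
  have "(c ^^ T) (overlay z x x') v = (c ^^ T) x' v" for v
  proof (cases "\<exists>u. near (int T * s) u v \<and> x u \<noteq> z")
    case True
    then obtain u where u: "near (int T * s) u v" "x u \<noteq> z" by blast
    have x'z: "x' w = z" if "near (int T * s) w v" for w
    proof (rule ccontr)
      assume "x' w \<noteq> z"
      moreover have "near (2 * (int T * s)) u w"
        using near_triangle[OF u(1), of "int T * s" w] that
        unfolding mult_2 by (simp only: near_commute[of _ v w])
      ultimately show False using far'[OF u(2) _ le] by blast
    qed
    have "(c ^^ T) (overlay z x x') v = (c ^^ T) x v"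
      by (rule iterate_local[OF mem x(1)]) (simp add: overlay_def x'z)
    moreover have "(c ^^ T) x' v = (c ^^ T) blank v"
      by (rule iterate_local[OF x(2) blank_mem]) (simp add: x'z)
    ultimately show ?thesis by (simp add: dead iterate_blank)
  next
    case False
    then show ?thesis
      by (intro iterate_local mem x) (auto simp: overlay_def)
  qed
  then have eq: "(c ^^ T) (overlay z x x') = (c ^^ T) x'" by (rule ext)
  assume "T \<le> n"
  then obtain k where "n = k + T" by (metis add.commute le_Suc_ex)
  then show "(c ^^ n) (overlay z x x') = (c ^^ n) x'"
    by (simp add: funpow_add eq)
qed

lemma overlay_periodic:
  assumes "periodic K q x" "periodic K q x'"
  shows "periodic K q (overlay z x x')"
proof -
  have "shift v (overlay z x x') = overlay z (shift v x) (shift v x')" for v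
    by (simp add: shift_def overlay_def)
  with assms show ?thesis by (simp add: periodic_def)
qed

lemma overlay_supported_in_tube:
  assumes "supported_in_tube z K b x" "supported_in_tube z K b' x'"
  shows "supported_in_tube z K (max b b') (overlay z x x')"
  using assms unfolding supported_in_tube_def overlay_def by (metis le_max_iff_disj)

lemma overlay_crystal:
  assumes "overlay z x x' \<in> X" "x \<in> crystal K q" "x' \<in> crystal K q"
  shows "overlay z x x' \<in> crystal K q"
  using assms overlay_periodic overlay_supported_in_tube unfolding crystal_def by blast

lemma crystal_multiple: "x \<in> crystal K q \<Longrightarrow> x \<in> crystal K (q * k)"
  by (auto simp: crystal_def periodic_mult)

definition crystals_mortal :: "'d set \<Rightarrow> bool" where
  "crystals_mortal K \<longleftrightarrow> (\<forall>q>0. \<forall>x\<in>crystal K q. mortal x)"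

text \<open>
  The locked window of the class of all crystals, whatever their period, is centred at some
  mortal crystal \<open>x\<close>. A crystal \<open>y\<close> that leaves a wide tube empty can be superposed with \<open>x\<close>, and
  the window is then blank from a time on that does not depend on \<open>y\<close>, although after the death
  of \<open>x\<close> only \<open>y\<close> can act on it.
\<close>

lemma empty_tube_shields:
  assumes mortal: "crystals_mortal J"
  obtains R N where "\<And>x q n. 0 < q \<Longrightarrow> x \<in> crystal J q
    \<Longrightarrow> (\<And>u. (\<And>j. j \<notin> J \<Longrightarrow> \<bar>u $ j\<bar> \<le> R) \<Longrightarrow> x u = z) \<Longrightarrow> N \<le> n \<Longrightarrow> (c ^^ n) x 0 = z"
proof -
  define C where "C = (\<Union>q\<in>{0<..}. crystal J q)"
  have "blank \<in> C"
    unfolding C_def by (rule UN_I[of 1]) (simp_all add: blank_crystal)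
  then have "C \<subseteq> X" "C \<noteq> {}" by (auto simp: C_def crystal_def)
  then obtain x b m where x: "x \<in> C" and lock:
      "\<And>y n w. y \<in> C \<Longrightarrow> (\<And>u. near b u 0 \<Longrightarrow> y u = x u) \<Longrightarrow> m \<le> n \<Longrightarrow> w \<in> {0}
        \<Longrightarrow> (c ^^ n) y w = z"
    using locked_window[of C "{0}"] by blast
  obtain p where p: "0 < p" "x \<in> crystal J p" using x by (auto simp: C_def)
  obtain a where xX: "x \<in> X" and a: "supported_in_tube z J a x" using p by (auto simp: crystal_def)
  obtain T where T: "(c ^^ T) x = blank" using mortal p by (auto simp: crystals_mortal_def mortal_def)
  define D where "D = 2 * s * int (Suc T)"
  show thesis
  proof (rule that[of "max b (a + D)" "max m T"])
    fix y q n
    assume q: "0 < q" and y: "y \<in> crystal J q"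
      and gap: "\<And>u. (\<And>j. j \<notin> J \<Longrightarrow> \<bar>u $ j\<bar> \<le> max b (a + D)) \<Longrightarrow> y u = z"
      and n: "max m T \<le> n"
    have yX: "y \<in> X" using y by (simp add: crystal_def)
    have far: "\<not> near D u u'" if "x u \<noteq> z" "y u' \<noteq> z" for u u'
    proof
      assume near: "near D u u'"
      have "\<bar>u' $ j\<bar> \<le> max b (a + D)" if "j \<notin> J" for j
      proof -
        have "\<bar>u $ j\<bar> \<le> a" using a \<open>x u \<noteq> z\<close> that by (simp add: supported_in_tube_def)
        moreover have "\<bar>u $ j - u' $ j\<bar> \<le> D" using near by (simp add: near_def)
        ultimately show ?thesis by linarith
      qed
      with gap that show False by blast
    qed
    note dead = overlay_dead[OF xX yX far[unfolded D_def] T]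
    have "overlay z x y \<in> crystal J (p * q)"
      using overlay_crystal[OF dead(1)] crystal_multiple[OF p(2), of q]
        crystal_multiple[OF y, of p] by (simp add: mult.commute)
    then have "overlay z x y \<in> C" using p q by (auto simp: C_def)
    moreover have "overlay z x y u = x u" if "near b u 0" for u
      using gap[of u] that by (simp add: overlay_def near_def le_max_iff_disj)
    ultimately have "(c ^^ n) (overlay z x y) 0 = z" using lock n by simp
    then show "(c ^^ n) y 0 = z" using dead(2) n by simp
  qed
qed

section \<open>Adding a period\<close>

text \<open>
  If \<open>x\<close> is supported where the coordinate \<open>i\<close> lies in \<open>{- h..<h}\<close>, this is the superposition
  of its translates by the multiples of \<open>2 * h\<close> in direction \<open>i\<close>.
\<close>

definition wrap :: "'d \<Rightarrow> int \<Rightarrow> ('a, 'd) config \<Rightarrow> ('a, 'd) config" where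
  "wrap i h x u = x (\<chi> k. if k = i then (u $ k + h) mod (2 * h) - h else u $ k)"

text \<open>
  The periodic copy agrees with a translate of \<open>x\<close> even somewhat beyond the fundamental domain,
  because both are blank at the seam. The margin is what makes \<open>wrap_mem\<close> work.
\<close>

lemma wrap_local:
  assumes b: "supported_in_tube z K b x" and i: "i \<notin> K" and h: "b < h" "0 \<le> b"
    and u: "\<bar>u $ i - 2 * h * k\<bar> < 2 * h - b"
  shows "wrap i h x u = shift (axis i (- (2 * h * k))) x u"
proof -
  have h0: "0 < h" using h by simp
  define t where "t = u $ i - 2 * h * k"
  define r where "r = (u $ i + h) mod (2 * h) - h"
  let ?w = "\<chi> k. if k = i then (u $ k + h) mod (2 * h) - h else u $ k"
  let ?w' = "u + axis i (- (2 * h * k))"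
  have wi: "?w $ i = r" and w'i: "?w' $ i = t"
    by (simp_all add: r_def t_def axis_def)
  have "u $ i + h = (t + h) + (2 * h) * k" by (simp add: t_def)
  then have r: "r = (t + h) mod (2 * h) - h"
    unfolding r_def by (metis mod_mult_self2)
  have z: "x w = z" if "b < \<bar>w $ i\<bar>" for w
    using b i that unfolding supported_in_tube_def by (meson not_less)
  have t: "\<bar>t\<bar> < 2 * h - b" using u by (simp add: t_def)
  have "x ?w = x ?w'"
  proof (cases "- h \<le> t \<and> t < h")
    case True
    then have "r = t" unfolding r using h0 by (subst mod_pos_pos_trivial) auto
    then have "?w = ?w'" by (auto simp: vec_eq_iff axis_def r_def t_def)
    then show ?thesis by simp
  next
    case False
    have "b < \<bar>r\<bar>"
    proof (cases "h \<le> t")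
      case True
      have "(t + h) mod (2 * h) = (t - h) mod (2 * h)"
        using mod_add_self2[of "t - h" "2 * h"] by (simp add: add.commute)
      also have "\<dots> = t - h"
        using True t h by (intro mod_pos_pos_trivial) auto
      finally show ?thesis using t h unfolding r by simp
    next
      case False': False
      have "(t + h) mod (2 * h) = (t + 3 * h) mod (2 * h)"
        using mod_add_self2[of "t + h" "2 * h"] by (simp add: algebra_simps)
      also have "\<dots> = t + 3 * h"
        using False False' t h by (intro mod_pos_pos_trivial) auto
      finally show ?thesis using t h unfolding r by simp
    qed
    then have "x ?w = z" by (intro z) (simp only: wi)
    moreover have "b < \<bar>t\<bar>" using False h by linarith
    then have "x ?w' = z" by (intro z) (simp only: w'i)
    ultimately show ?thesis by simp
  qed
  then show ?thesis by (simp add: wrap_def shift_def)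
qed

lemma wrap_mem:
  assumes x: "x \<in> X" and b: "supported_in_tube z K b x" "i \<notin> K" and h: "b + s < h" "0 \<le> b"
  shows "wrap i h x \<in> X"
proof (rule glue)
  fix v :: "int ^ 'd"
  have h0: "0 < h" using h radius_nonneg by simp
  define k where "k = (v $ i + h) div (2 * h)"
  have "v $ i + h = 2 * h * k + (v $ i + h) mod (2 * h)" by (simp add: k_def)
  then have v: "\<bar>v $ i - 2 * h * k\<bar> \<le> h"
    using pos_mod_sign[of "2 * h" "v $ i + h"] pos_mod_bound[of "2 * h" "v $ i + h"] h0
    by linarith
  have "wrap i h x u = shift (axis i (- (2 * h * k))) x u" if "near s u v" for u
  proof (rule wrap_local[OF b])
    have "\<bar>u $ i - v $ i\<bar> \<le> s" using that by (simp add: near_def)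
    then show "\<bar>u $ i - 2 * h * k\<bar> < 2 * h - b" using v h by linarith
  qed (use h radius_nonneg in linarith)+
  then show "\<exists>x'\<in>X. \<forall>u. near s u v \<longrightarrow> wrap i h x u = x' u"
    using shift_mem[OF x] by blast
qed

lemma wrap_periodic:
  assumes x: "periodic K q x" and i: "i \<notin> K"
  shows "periodic (insert i K) (2 * (q * k)) (wrap i (q * k) x)"
  unfolding periodic_def
proof
  fix j assume j: "j \<in> insert i K"
  let ?h = "q * k"
  let ?r = "\<lambda>u. (\<chi> k. if k = i then (u $ k + ?h) mod (2 * ?h) - ?h else u $ k) :: int ^ 'd"
  have "x (?r (u + axis j (2 * ?h))) = x (?r u)" for u
  proof (cases "j = i")
    case True
    have "(u $ i + 2 * ?h + ?h) mod (2 * ?h) = (u $ i + ?h) mod (2 * ?h)"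
      using mod_add_self2[of "u $ i + ?h" "2 * ?h"] by (simp add: algebra_simps)
    then have "?r (u + axis j (2 * ?h)) = ?r u"
      using True by (auto simp: vec_eq_iff axis_def)
    then show ?thesis by (simp only:)
  next
    case False
    then have "?r (u + axis j (2 * ?h)) = ?r u + axis j (2 * ?h)"
      by (auto simp: vec_eq_iff axis_def)
    moreover have "shift (axis j (2 * ?h)) x = x"
      using periodic_mult[OF x, of "2 * k"] j False
      by (simp add: periodic_def mult.left_commute)
    then have "shift (axis j (2 * ?h)) x (?r u) = x (?r u)" by (rule arg_cong)
    then have "x (?r u + axis j (2 * ?h)) = x (?r u)" by (simp only: shift_def)
    ultimately show ?thesis by (simp only:)
  qed
  then show "shift (axis j (2 * ?h)) (wrap i ?h x) = wrap i ?h x"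
    by (simp add: shift_def wrap_def fun_eq_iff)
qed

lemma wrap_supported_in_tube:
  assumes "supported_in_tube z K b x"
  shows "supported_in_tube z (insert i K) b (wrap i h x)"
  unfolding supported_in_tube_def wrap_def
proof (intro allI impI)
  fix u j
  let ?w = "\<chi> k. if k = i then (u $ k + h) mod (2 * h) - h else u $ k"
  assume "x ?w \<noteq> z" and j: "j \<notin> insert i K"
  then have "\<bar>?w $ j\<bar> \<le> b" using assms unfolding supported_in_tube_def by blast
  then show "\<bar>u $ j\<bar> \<le> b" using j by simp
qed

lemma crystal_bound:
  assumes "x \<in> crystal K q"
  obtains b where "0 \<le> b" "supported_in_tube z K b x"
proof -
  obtain b where "supported_in_tube z K b x" using assms by (auto simp: crystal_def)
  then have "supported_in_tube z K \<bar>b\<bar> x" by (rule supported_in_tube_mono) simp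
  then show thesis by (intro that[of "\<bar>b\<bar>"]) simp_all
qed

text \<open>
  The shielding property is inherited by configurations that are only bounded in direction \<open>i\<close>:
  wrapped with a period that is large compared to \<open>n\<close>, they look the same at the origin up to
  time \<open>n\<close>. It matters here that the time \<open>N\<close> is independent of the period.
\<close>

lemma empty_tube_shields_along:
  assumes mortal: "crystals_mortal (insert i K)" and i: "i \<notin> K"
  obtains R N where "\<And>x q n. 0 < q \<Longrightarrow> x \<in> crystal K q
    \<Longrightarrow> (\<And>u. (\<And>j. j \<notin> insert i K \<Longrightarrow> \<bar>u $ j\<bar> \<le> R) \<Longrightarrow> x u = z) \<Longrightarrow> N \<le> n \<Longrightarrow> (c ^^ n) x 0 = z"
proof -
  obtain R N where R: "\<And>x q n. 0 < q \<Longrightarrow> x \<in> crystal (insert i K) q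
    \<Longrightarrow> (\<And>u. (\<And>j. j \<notin> insert i K \<Longrightarrow> \<bar>u $ j\<bar> \<le> R) \<Longrightarrow> x u = z) \<Longrightarrow> N \<le> n \<Longrightarrow> (c ^^ n) x 0 = z"
    using empty_tube_shields[OF mortal] by blast
  show thesis
  proof (rule that[of R N])
    fix x q n
    assume q: "0 < q" and x: "x \<in> crystal K q" and n: "N \<le> n"
      and gap: "\<And>u. (\<And>j. j \<notin> insert i K \<Longrightarrow> \<bar>u $ j\<bar> \<le> R) \<Longrightarrow> x u = z"
    have xX: "x \<in> X" "periodic K q x" using x by (auto simp: crystal_def)
    obtain b where b: "0 \<le> b" "supported_in_tube z K b x" using crystal_bound[OF x] .
    \<comment> \<open>The period is a multiple of \<open>q\<close>, so that the periods in the directions \<open>K\<close> survive.\<close>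
    define l where "l = b + s + int n * s + 1"
    have "0 \<le> int n * s" using radius_nonneg by simp
    then have l: "b + s < l" "b < l" "b + int n * s < l"
      using radius_nonneg b(1) unfolding l_def by linarith+
    define h where "h = q * l"
    have "l \<le> h" using q l b(1) mult_right_mono[of 1 q l] by (simp add: h_def)
    then have h: "b + s < h" "b < h" "b + int n * s < h" "0 < h" using l b(1) by linarith+
    note wX = wrap_mem[OF xX(1) b(2) i h(1) b(1)]
    let ?y = "wrap i h x"
    have "?y \<in> crystal (insert i K) (2 * h)"
      using wX wrap_periodic[OF xX(2) i, of l] wrap_supported_in_tube[OF b(2)]
      by (auto simp: crystal_def h_def)
    moreover have "?y u = z" if "\<And>j. j \<notin> insert i K \<Longrightarrow> \<bar>u $ j\<bar> \<le> R" for u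
      unfolding wrap_def by (rule gap) (use that in auto)
    ultimately have "(c ^^ n) ?y 0 = z"
      using R[of "2 * h" ?y n] h(4) n by simp
    moreover have "(c ^^ n) ?y 0 = (c ^^ n) x 0"
    proof (rule iterate_local[OF wX xX(1)])
      fix u :: "int ^ 'd" assume "near (int n * s) u 0"
      then have "\<bar>u $ i\<bar> \<le> int n * s" by (simp add: near_def)
      then have "\<bar>u $ i - 2 * h * 0\<bar> < 2 * h - b" using h by linarith
      from wrap_local[OF b(2) i h(2) b(1) this] show "?y u = x u"
        by (simp add: shift_def axis_def zero_vec_def[symmetric])
    qed
    ultimately show "(c ^^ n) x 0 = z" by simp
  qed
qed

text \<open>
  Seen from a cell far away from \<open>x\<close> orthogonally to \<open>i\<close>, the whole tube along \<open>i\<close> is empty.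
\<close>

lemma eventually_bounded_across:
  assumes mortal: "crystals_mortal (insert i K)" and i: "i \<notin> K"
    and q: "0 < q" and x: "x \<in> crystal K q"
  obtains b N where "\<And>n. N \<le> n \<Longrightarrow> supported_in_tube z (insert i K) b ((c ^^ n) x)"
proof -
  obtain R N where R: "\<And>x q n. 0 < q \<Longrightarrow> x \<in> crystal K q
    \<Longrightarrow> (\<And>u. (\<And>j. j \<notin> insert i K \<Longrightarrow> \<bar>u $ j\<bar> \<le> R) \<Longrightarrow> x u = z) \<Longrightarrow> N \<le> n \<Longrightarrow> (c ^^ n) x 0 = z"
    using empty_tube_shields_along[OF mortal i] by blast
  obtain b where xX: "x \<in> X" and b: "supported_in_tube z K b x"
    using x by (auto simp: crystal_def)
  have "supported_in_tube z (insert i K) (b + R) ((c ^^ n) x)" if n: "N \<le> n" for n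
    unfolding supported_in_tube_def
  proof (intro allI impI, rule ccontr)
    fix v j
    assume nz: "(c ^^ n) x v \<noteq> z" and j: "j \<notin> insert i K" "\<not> \<bar>v $ j\<bar> \<le> b + R"
    have "(c ^^ n) (shift v x) 0 = z"
    proof (rule R[OF q shift_crystal[OF x] _ n])
      fix u assume "\<And>j. j \<notin> insert i K \<Longrightarrow> \<bar>u $ j\<bar> \<le> R"
      then have "\<bar>u $ j\<bar> \<le> R" using j(1) by blast
      then have "\<not> \<bar>(u + v) $ j\<bar> \<le> b" using j(2) unfolding vector_add_component by linarith
      then show "shift v x u = z"
        using b j(1) unfolding supported_in_tube_def shift_def by blast
    qed
    with nz show False by (simp add: iterate_shift_apply[OF xX])
  qed
  then show thesis by (rule that)
qed

section \<open>Walls in a single free direction\<close>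

definition cut :: "'d \<Rightarrow> int \<Rightarrow> ('a, 'd) config \<Rightarrow> ('a, 'd) config" where
  "cut i V x u = (if \<bar>u $ i\<bar> \<le> V then x u else z)"

lemma cut_local:
  assumes wall: "\<And>u. \<bar>\<bar>u $ i\<bar> - V\<bar> \<le> s \<Longrightarrow> x u = z" and u: "near s u v"
  shows "\<bar>v $ i\<bar> \<le> V \<Longrightarrow> cut i V x u = x u" and "\<not> \<bar>v $ i\<bar> \<le> V \<Longrightarrow> cut i V x u = z"
proof -
  have "\<bar>u $ i - v $ i\<bar> \<le> s" using u by (simp add: near_def)
  then show "\<bar>v $ i\<bar> \<le> V \<Longrightarrow> cut i V x u = x u" "\<not> \<bar>v $ i\<bar> \<le> V \<Longrightarrow> cut i V x u = z"
    unfolding cut_def by (auto intro!: wall wall[symmetric])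
qed

text \<open>
  Blank walls of thickness \<open>s\<close> hide the two sides from each other, both for membership in \<open>X\<close> and
  for one step of \<open>c\<close>, so that erasing the outside commutes with \<open>c\<close>.
\<close>

lemma cut_step:
  assumes x: "x \<in> X" and wall: "\<And>u. \<bar>\<bar>u $ i\<bar> - V\<bar> \<le> s \<Longrightarrow> x u = z"
  shows "cut i V x \<in> X" and "c (cut i V x) = cut i V (c x)"
proof -
  have loc: "\<bar>v $ i\<bar> \<le> V \<Longrightarrow> cut i V x u = x u" "\<not> \<bar>v $ i\<bar> \<le> V \<Longrightarrow> cut i V x u = z"
    if "near s u v" for u v
    using cut_local[of i V x u v, OF wall that] by auto
  show mem: "cut i V x \<in> X"
  proof (rule glue)
    fix v show "\<exists>x'\<in>X. \<forall>u. near s u v \<longrightarrow> cut i V x u = x' u"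
    proof (cases "\<bar>v $ i\<bar> \<le> V")
      case True
      then show ?thesis using x loc(1) by blast
    next
      case False
      then show ?thesis using blank_mem loc(2) by (intro bexI[of _ blank]) auto
    qed
  qed
  show "c (cut i V x) = cut i V (c x)"
  proof
    fix v
    show "c (cut i V x) v = cut i V (c x) v"
    proof (cases "\<bar>v $ i\<bar> \<le> V")
      case True
      then have "c (cut i V x) v = c x v" by (intro step_local mem x loc)
      then show ?thesis using True by (simp add: cut_def)
    next
      case False
      then have "c (cut i V x) v = c blank v" by (intro step_local mem blank_mem loc)
      then show ?thesis using False by (simp add: cut_def step_blank)
    qed
  qed
qed

lemma cut_iterate:
  assumes x: "x \<in> X" and wall: "\<And>n u. \<bar>\<bar>u $ i\<bar> - V\<bar> \<le> s \<Longrightarrow> (c ^^ n) x u = z"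
  shows "(c ^^ n) (cut i V x) = cut i V ((c ^^ n) x)"
proof (induction n)
  case (Suc n)
  then show ?case using cut_step(2)[OF iterate_mem[OF x, of n] wall] by simp
qed simp

text \<open>
  When \<open>i\<close> is the only free direction, a finite window contains a fundamental domain of the slab of
  width \<open>s\<close>. The crystal \<open>y\<close> is thus a word whose occurrence at any position \<open>a\<close> creates a wall
  there, whatever the rest of the configuration does.
\<close>

lemma locked_slab:
  assumes K: "\<And>j. j \<notin> K \<longleftrightarrow> j = i" and p: "0 < p"
  obtains y b m where "y \<in> crystal K p"
    and "\<And>x a n u. x \<in> crystal K p \<Longrightarrow> (\<And>u. \<bar>u $ i - a\<bar> \<le> b \<Longrightarrow> x u = y (u - axis i a)) \<Longrightarrow>
      m \<le> n \<Longrightarrow> \<bar>u $ i - a\<bar> \<le> s \<Longrightarrow> (c ^^ n) x u = z"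
proof -
  have C: "crystal K p \<subseteq> X" "crystal K p \<noteq> {}"
    using blank_crystal[of K p] by (auto simp: crystal_def)
  obtain y b m where y: "y \<in> crystal K p" and lock:
      "\<And>x n w. x \<in> crystal K p \<Longrightarrow> (\<And>u. near b u 0 \<Longrightarrow> x u = y u) \<Longrightarrow> m \<le> n
        \<Longrightarrow> w \<in> {w. near (p + s) w 0} \<Longrightarrow> (c ^^ n) x w = z"
    using locked_window[OF C finite_near[of "p + s"]] by blast
  show thesis
  proof (rule that[OF y, of b m])
    fix x a n and u :: "int ^ 'd"
    assume x: "x \<in> crystal K p" and eq: "\<And>u. \<bar>u $ i - a\<bar> \<le> b \<Longrightarrow> x u = y (u - axis i a)"
      and n: "m \<le> n" and u: "\<bar>u $ i - a\<bar> \<le> s"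
    let ?x = "shift (axis i a) x"
    have xX: "x \<in> X" using x by (simp add: crystal_def)
    have x': "?x \<in> crystal K p" by (rule shift_crystal[OF x])
    then have per: "periodic K p ((c ^^ n) ?x)"
      by (simp add: crystal_def iterate_periodic)
    define v where "v = u - axis i a"
    let ?w = "\<chi> j. if j \<in> K then v $ j mod p else v $ j"
    have vi: "\<bar>v $ i\<bar> \<le> s" using u by (simp add: v_def axis_def)
    have "\<bar>?w $ j\<bar> \<le> p + s" for j
    proof (cases "j \<in> K")
      case True
      then show ?thesis
        using pos_mod_bound[OF p, of "v $ j"] pos_mod_sign[OF p, of "v $ j"] radius_nonneg by simp
    next
      case False
      then show ?thesis using vi K[of j] p by simp
    qed
    then have w: "near (p + s) ?w 0" by (simp add: near_def)
    have "?x u' = y u'" if "near b u' 0" for u'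
    proof -
      have "\<bar>(u' + axis i a) $ i - a\<bar> \<le> b" using that by (simp add: near_def axis_def)
      from eq[OF this] show ?thesis by (simp add: shift_def)
    qed
    from lock[OF x' this n, of ?w] w have "(c ^^ n) ?x ?w = z" by simp
    then have "(c ^^ n) ?x v = z" using periodic_reduce[OF per, of v] by simp
    then show "(c ^^ n) x u = z" by (simp add: iterate_shift_apply[OF xX] v_def)
  qed
qed

lemma cut_crystal:
  assumes K: "\<And>j. j \<notin> K \<longleftrightarrow> j = i" and "cut i V x \<in> X" "periodic K q x"
  shows "cut i V x \<in> crystal K q" "supported_in_tube z K V (cut i V x)"
proof -
  show off: "supported_in_tube z K V (cut i V x)"
    using K by (auto simp: supported_in_tube_def cut_def)
  have "shift (axis k q) (cut i V x) = cut i V x" if "k \<in> K" for k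
  proof -
    have "k \<noteq> i" using that K by blast
    then have "shift (axis k q) (cut i V x) = cut i V (shift (axis k q) x)"
      by (simp add: shift_def cut_def fun_eq_iff axis_def)
    then show ?thesis using assms(3) that by (simp add: periodic_def)
  qed
  then show "cut i V x \<in> crystal K q"
    using off assms(2) by (auto simp: crystal_def periodic_def)
qed

text \<open>
  The walls need \<open>m\<close> steps to form. Therefore the truncated crystal \<open>h\<close> is taken from the
  configuration at time \<open>m\<close>, and a hit by \<open>h\<close> at time \<open>N\<close> is a hit by the translate of
  \<open>x\<close> at time \<open>N + m\<close>.
\<close>

lemma crystals_mortal_one_free_direction:
  assumes K: "\<And>j. j \<notin> K \<longleftrightarrow> j = i"
  shows "crystals_mortal K"
  unfolding crystals_mortal_def
proof (intro allI impI ballI, rule ccontr)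
  fix p x assume p: "0 < p" and x: "x \<in> crystal K p" and immortal: "\<not> mortal x"
  have supp: "supported_in_tube z K b w \<longleftrightarrow> (\<forall>u. w u \<noteq> z \<longrightarrow> \<bar>u $ i\<bar> \<le> b)" for b w
    using K by (auto simp: supported_in_tube_def)
  obtain y b0 m where y: "y \<in> crystal K p" and wall0:
      "\<And>x a n u. x \<in> crystal K p \<Longrightarrow> (\<And>u. \<bar>u $ i - a\<bar> \<le> b0 \<Longrightarrow> x u = y (u - axis i a)) \<Longrightarrow>
      m \<le> n \<Longrightarrow> \<bar>u $ i - a\<bar> \<le> s \<Longrightarrow> (c ^^ n) x u = z"
    using locked_slab[OF K p] by blast
  define b where "b = \<bar>b0\<bar>"
  have b: "0 \<le> b" "b0 \<le> b" by (simp_all add: b_def)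
  have wall: "(c ^^ n) w u = z" if "w \<in> crystal K p"
    "\<And>u. \<bar>u $ i - a\<bar> \<le> b \<Longrightarrow> w u = y (u - axis i a)" "m \<le> n" "\<bar>u $ i - a\<bar> \<le> s" for w a n u
    using wall0[OF that(1) _ that(3,4)] that(2) b(2) order_trans by blast
  define C where "C = {x \<in> crystal K p. mortal x}"
  have "blank \<in> C"
    using blank_crystal iterate_blank by (simp add: C_def mortal_def)
  then have "C \<subseteq> X" "C \<noteq> {}" by (auto simp: C_def crystal_def)
  then obtain x' b' m' where "x' \<in> C" and lock:
      "\<And>w n v. w \<in> C \<Longrightarrow> (\<And>u. near b' u 0 \<Longrightarrow> w u = x' u) \<Longrightarrow> m' \<le> n \<Longrightarrow> v \<in> {0}
        \<Longrightarrow> (c ^^ n) w v = z"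
    using locked_window[of C "{0}"] by blast
  then have x': "x' \<in> crystal K p" "mortal x'" by (simp_all add: C_def)
  obtain T where T: "(c ^^ T) x' = blank" using x'(2) by (auto simp: mortal_def)
  have X: "x \<in> X" "y \<in> X" "x' \<in> X" and per: "periodic K p x"
    using x y x' by (auto simp: crystal_def)
  obtain \<beta> where \<beta>: "0 \<le> \<beta>" "supported_in_tube z K \<beta> x" using crystal_bound[OF x] .
  obtain \<eta> where \<eta>: "0 \<le> \<eta>" "supported_in_tube z K \<eta> y" using crystal_bound[OF y] .
  obtain \<beta>' where \<beta>': "0 \<le> \<beta>'" "supported_in_tube z K \<beta>' x'" using crystal_bound[OF x'(1)] .
  \<comment> \<open>A crystal that is blank on the slab of width \<open>\<rho>\<close> can be added to \<open>x'\<close> without disturbing its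
    death and without changing the box on which \<open>x'\<close> is locked.\<close>
  define D where "D = 2 * s * int (Suc T)"
  define \<rho> where "\<rho> = max b' (\<beta>' + D)"
  have "0 \<le> D" using radius_nonneg by (simp add: D_def)
  then have \<rho>: "0 \<le> \<rho>" "b' \<le> \<rho>" "\<beta>' + D \<le> \<rho>" using \<beta>'(1) by (simp_all add: \<rho>_def)
  \<comment> \<open>Activity of \<open>x\<close> at distance more than \<open>k\<close>: moved to the origin, it comes from a translate of
    \<open>x\<close> that is still outside of the slab of width \<open>\<rho>\<close> when the walls have formed.\<close>
  define k where "k = \<rho> + int m * s + \<beta>"
  obtain M where M: "\<And>n u. M \<le> n \<Longrightarrow> (\<And>j. j \<notin> K \<Longrightarrow> \<bar>u $ j\<bar> \<le> k) \<Longrightarrow> (c ^^ n) x u = z"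
    using tube_vanishing[OF X(1) per p] by blast
  define N where "N = max T (max m' M)"
  have N: "T \<le> N" "m' \<le> N" "M \<le> N + m" by (simp_all add: N_def)
  obtain v where v: "(c ^^ (N + m)) x v \<noteq> z"
    using immortal unfolding mortal_def by (metis ext)
  have vk: "k < \<bar>v $ i\<bar>"
  proof (rule ccontr)
    assume "\<not> k < \<bar>v $ i\<bar>"
    then show False using M[OF N(3), of v] v K by simp
  qed
  define x1 where "x1 = shift v x"
  have x1: "x1 \<in> crystal K p" "x1 \<in> X" and hit: "(c ^^ (N + m)) x1 0 \<noteq> z"
    using shift_crystal[OF x] v X(1)
    by (simp_all add: x1_def shift_mem iterate_shift_apply)
  define \<beta>1 where "\<beta>1 = \<beta> + \<bar>v $ i\<bar>"
  have supp1: "\<rho> + int m * s < \<bar>u $ i\<bar> \<and> \<bar>u $ i\<bar> \<le> \<beta>1" if "x1 u \<noteq> z" for u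
  proof -
    have "\<bar>u $ i + v $ i\<bar> \<le> \<beta>"
      using \<beta>(2) that unfolding supp x1_def shift_def by force
    then show ?thesis using vk unfolding k_def \<beta>1_def by linarith
  qed
  \<comment> \<open>The walls stand at \<open>V\<close> and \<open>- V\<close>, too far away to be noticed at the origin up to time
    \<open>N + m\<close>.\<close>
  define V where "V = \<beta>1 + \<eta> + b + 2 * s + int (N + m) * s + \<rho> + int m * s + 1"
  have nn: "0 \<le> \<beta>1" "0 \<le> int (N + m) * s" "0 \<le> int m * s"
    using \<beta>(1) radius_nonneg by (simp_all add: \<beta>1_def)
  have V: "0 \<le> V" "\<beta>1 + 2 * s < V - \<eta>" "\<beta>1 < V - b" "\<eta> < V" "\<eta> + b < V"
      "int (N + m) * s < V - \<eta>" "\<rho> + int m * s < V - \<eta>"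
    using nn \<eta>(1) b(1) radius_nonneg \<rho>(1) unfolding V_def by linarith+
  define yr yl where "yr = shift (axis i (- V)) y" and "yl = shift (axis i V) y"
  have yr: "yr \<in> crystal K p" "yr \<in> X" and yl: "yl \<in> crystal K p" "yl \<in> X"
    using shift_crystal[OF y] shift_mem[OF X(2)] by (simp_all add: yr_def yl_def)
  have yr_supp: "\<bar>u $ i - V\<bar> \<le> \<eta>" if "yr u \<noteq> z" for u
    using \<eta>(2) that unfolding supp yr_def shift_def by (force simp: axis_def)
  have yl_supp: "\<bar>u $ i + V\<bar> \<le> \<eta>" if "yl u \<noteq> z" for u
    using \<eta>(2) that unfolding supp yl_def shift_def by (force simp: axis_def)
  \<comment> \<open>The configuration \<open>w\<close> consists of \<open>yl\<close>, \<open>x1\<close> and \<open>yr\<close>, from left to right.\<close>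
  define w1 where "w1 = overlay z x1 yl"
  have "w1 \<in> X" unfolding w1_def
  proof (rule overlay_mem[OF x1(2) yl(2)])
    fix u u' assume "x1 u \<noteq> z" "yl u' \<noteq> z"
    then have "\<not> \<bar>u $ i - u' $ i\<bar> \<le> 2 * s" using supp1[of u] yl_supp[of u'] V by linarith
    then show "\<not> near (2 * s) u u'" unfolding near_def by blast
  qed
  then have w1: "w1 \<in> X" "w1 \<in> crystal K p"
    using overlay_crystal[OF _ x1(1) yl(1)] by (simp_all add: w1_def)
  have w1_supp: "u $ i \<le> \<beta>1" if "w1 u \<noteq> z" for u
  proof (cases "x1 u = z")
    case True
    then have "yl u \<noteq> z" using that by (simp add: w1_def overlay_def)
    from yl_supp[OF this] show ?thesis using V nn by linarith
  next
    case False
    from supp1[OF this] show ?thesis by linarith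
  qed
  define w where "w = overlay z yr w1"
  have "w \<in> X" unfolding w_def
  proof (rule overlay_mem[OF yr(2) w1(1)])
    fix u u' assume "yr u \<noteq> z" "w1 u' \<noteq> z"
    then have "\<not> \<bar>u $ i - u' $ i\<bar> \<le> 2 * s" using yr_supp[of u] w1_supp[of u'] V by linarith
    then show "\<not> near (2 * s) u u'" unfolding near_def by blast
  qed
  then have w: "w \<in> X" "w \<in> crystal K p"
    using overlay_crystal[OF _ yr(1) w1(2)] by (simp_all add: w_def)
  have w_right: "w u = y (u - axis i V)" if "\<bar>u $ i - V\<bar> \<le> b" for u
  proof -
    have "w1 u = z" using w1_supp[of u] that V by linarith
    then have "w u = yr u" by (simp add: w_def overlay_def)
    also have "u + axis i (- V) = u - axis i V" by (simp add: vec_eq_iff axis_def)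
    then have "yr u = y (u - axis i V)" by (simp add: yr_def shift_def)
    finally show ?thesis .
  qed
  have w_left: "w u = y (u - axis i (- V))" if "\<bar>u $ i - - V\<bar> \<le> b" for u
  proof -
    have "yr u = z" using yr_supp[of u] that V by linarith
    moreover have "x1 u = z" using supp1[of u] that V by linarith
    ultimately have "w u = yl u" by (simp add: w_def w1_def overlay_def)
    also have "u + axis i V = u - axis i (- V)" by (simp add: vec_eq_iff axis_def)
    then have "yl u = y (u - axis i (- V))" by (simp add: yl_def shift_def)
    finally show ?thesis .
  qed
  have w_mid: "w u = x1 u" if "\<bar>u $ i\<bar> < V - \<eta>" for u
  proof -
    have "yr u = z" "yl u = z" using yr_supp[of u] yl_supp[of u] that by linarith+
    then show ?thesis by (simp add: w_def w1_def overlay_def)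
  qed
  define g where "g = (c ^^ m) w"
  have gX: "g \<in> X" "periodic K p g" and g: "(c ^^ n) g = (c ^^ (n + m)) w" for n
    using w iterate_crystal[OF w(2), of m] by (simp_all add: g_def iterate_mem crystal_def funpow_add)
  have walls: "(c ^^ n) g u = z" if "\<bar>\<bar>u $ i\<bar> - V\<bar> \<le> s" for n u
  proof (cases "0 \<le> u $ i")
    case True
    then show ?thesis
      unfolding g using that by (intro wall[OF w(2) w_right]) auto
  next
    case False
    then show ?thesis
      unfolding g using that by (intro wall[OF w(2) w_left]) auto
  qed
  define h where "h = cut i V g"
  have hX: "h \<in> X" unfolding h_def using cut_step(1)[OF gX(1)] walls[of _ 0] by simp
  have h_iter: "(c ^^ n) h = cut i V ((c ^^ n) g)" for n
    unfolding h_def by (rule cut_iterate[OF gX(1) walls])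
  have h: "h \<in> crystal K p"
    using cut_crystal(1)[OF K _ gX(2)] hX by (simp add: h_def)
  \<comment> \<open>Between the walls nothing gets out, so \<open>h\<close> is confined.\<close>
  have "mortal h"
  proof (rule confined_mortal[OF hX _ p])
    show "periodic K p h" using h by (simp add: crystal_def)
    show "supported_in_tube z K V ((c ^^ n) h)" for n
      unfolding supp h_iter cut_def by simp
  qed
  then obtain T' where T': "(c ^^ T') h = blank" by (auto simp: mortal_def)
  have h_gap: "h u = z" if "\<bar>u $ i\<bar> \<le> \<rho>" for u
  proof -
    have "(c ^^ m) w u = (c ^^ m) blank u"
    proof (rule iterate_local[OF w(1) blank_mem])
      fix u' assume "near (int m * s) u' u"
      then have "\<bar>u' $ i - u $ i\<bar> \<le> int m * s" by (simp add: near_def)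
      then have "\<bar>u' $ i\<bar> \<le> \<rho> + int m * s" using that by linarith
      then show "w u' = z" using w_mid[of u'] supp1[of u'] V by force
    qed
    then show ?thesis by (simp add: h_def g_def cut_def iterate_blank)
  qed
  have far: "\<not> near D u u'" if "x' u \<noteq> z" "h u' \<noteq> z" for u u'
  proof -
    have "\<bar>u $ i\<bar> \<le> \<beta>'" using \<beta>'(2) that(1) by (simp add: supp)
    moreover have "\<rho> < \<bar>u' $ i\<bar>" using h_gap that(2) not_less by blast
    ultimately have "\<not> \<bar>u $ i - u' $ i\<bar> \<le> D" using \<rho>(3) by linarith
    then show ?thesis unfolding near_def by blast
  qed
  note dead = overlay_dead[OF X(3) hX far[unfolded D_def] T]
  \<comment> \<open>The superposition is mortal and agrees with \<open>x'\<close> near the origin, so it cannot hit it at the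
    late time \<open>N\<close>; but it does, because \<open>h\<close> does.\<close>
  have "(c ^^ max T T') (overlay z x' h) = blank"
    using dead(2) dead_stays_dead[OF T'] by simp
  then have "overlay z x' h \<in> C"
    using overlay_crystal[OF dead(1) x'(1) h] unfolding C_def mortal_def by blast
  moreover have "overlay z x' h u = x' u" if "near b' u 0" for u
  proof -
    have "\<bar>u $ i\<bar> \<le> \<rho>" using near_mono[OF that \<rho>(2)] by (simp add: near_def)
    then show ?thesis using h_gap by (simp add: overlay_def)
  qed
  ultimately have "(c ^^ N) (overlay z x' h) 0 = z" using lock N(2) by simp
  then have "(c ^^ N) h 0 = z" using dead(2) N(1) by simp
  then have "(c ^^ (N + m)) w 0 = z" using V(1) by (simp add: h_iter cut_def g)
  moreover have "(c ^^ (N + m)) w 0 = (c ^^ (N + m)) x1 0"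
  proof (rule iterate_local[OF w(1) x1(2)])
    fix u :: "int ^ 'd" assume "near (int (N + m) * s) u 0"
    then have "\<bar>u $ i\<bar> \<le> int (N + m) * s" by (simp add: near_def)
    then show "w u = x1 u" using V(6) by (intro w_mid) linarith
  qed
  ultimately show False using hit by simp
qed

section \<open>Mortality and nilpotency\<close>

lemma all_crystals_mortal: "crystals_mortal K"
proof (induction "card (- K)" arbitrary: K rule: less_induct)
  case less
  consider "K = UNIV" | i where "- K = {i}" | i i' where "i \<notin> K" "i' \<notin> K" "i \<noteq> i'"
    by blast
  then show ?case
  proof cases
    case 1
    show ?thesis
      unfolding crystals_mortal_def
    proof (intro allI impI ballI)
      fix q x assume "0 < q" "x \<in> crystal K q"
      then show "mortal x"
        using 1 by (intro confined_mortal[of x K q 0 0]) (auto simp: crystal_def supported_in_tube_def)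
    qed
  next
    case 2
    then show ?thesis by (intro crystals_mortal_one_free_direction) blast
  next
    case 3
    \<comment> \<open>Escape along \<open>i\<close> is excluded by the tubes along \<open>i'\<close>, and vice versa.\<close>
    have smaller: "crystals_mortal (insert j K)" if "j \<notin> K" for j
      by (rule less) (use that in \<open>auto intro!: psubset_card_mono\<close>)
    show ?thesis
      unfolding crystals_mortal_def
    proof (intro allI impI ballI)
      fix q x assume q: "0 < q" and x: "x \<in> crystal K q"
      obtain b N where b: "\<And>n. N \<le> n \<Longrightarrow> supported_in_tube z (insert i K) b ((c ^^ n) x)"
        using eventually_bounded_across[OF smaller[OF 3(1)] 3(1) q x] by blast
      obtain b' N' where b': "\<And>n. N' \<le> n \<Longrightarrow> supported_in_tube z (insert i' K) b' ((c ^^ n) x)"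
        using eventually_bounded_across[OF smaller[OF 3(2)] 3(2) q x] by blast
      have "supported_in_tube z K (max b b') ((c ^^ n) x)" if "max N N' \<le> n" for n
        using b[of n] b'[of n] that 3(3) unfolding supported_in_tube_def
        by (metis insert_iff max.bounded_iff le_max_iff_disj)
      then show "mortal x"
        using x by (intro confined_mortal[OF _ _ q, of x K "max N N'"]) (auto simp: crystal_def)
    qed
  qed
qed

text \<open>
  The case of no periods at all. The bound passes from finite configurations to all of \<open>X\<close> since
  for each single time the value at the origin depends on a box only.
\<close>

lemma empty_box_shields:
  assumes dense: "\<And>x b. x \<in> X \<Longrightarrow> \<exists>y\<in>X. finite_config z y \<and> (\<forall>u. near b u 0 \<longrightarrow> y u = x u)"
  obtains R N where "\<And>x n. x \<in> X \<Longrightarrow> (\<And>u. near R u 0 \<Longrightarrow> x u = z) \<Longrightarrow> N \<le> n \<Longrightarrow> (c ^^ n) x 0 = z"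
proof -
  obtain R N where R: "\<And>x q n. 0 < q \<Longrightarrow> x \<in> crystal {} q
    \<Longrightarrow> (\<And>u. (\<And>j. j \<notin> {} \<Longrightarrow> \<bar>u $ j\<bar> \<le> R) \<Longrightarrow> x u = z) \<Longrightarrow> N \<le> n \<Longrightarrow> (c ^^ n) x 0 = z"
    using empty_tube_shields[OF all_crystals_mortal] by blast
  show thesis
  proof (rule that[of R N])
    fix x n assume x: "x \<in> X" and gap: "\<And>u. near R u 0 \<Longrightarrow> x u = z" and n: "N \<le> n"
    obtain y where y: "y \<in> X" "finite_config z y"
        "\<And>u. near (max R (int n * s)) u 0 \<Longrightarrow> y u = x u"
      using dense[OF x] by blast
    obtain f where f: "\<And>u :: int ^ 'd. near (f u) u 0" using ex_near by metis
    have "supported_in_tube z {} (Max (f ` {v. y v \<noteq> z})) y"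
      unfolding supported_in_tube_def
    proof (intro allI impI)
      fix u j assume "y u \<noteq> z"
      then have "f u \<le> Max (f ` {v. y v \<noteq> z})"
        using y(2) by (simp add: finite_config_def)
      then show "\<bar>u $ j\<bar> \<le> Max (f ` {v. y v \<noteq> z})"
        using f[of u] unfolding near_def by (simp, meson order_trans)
    qed
    then have "y \<in> crystal {} 1" using y(1) by (auto simp: crystal_def periodic_def)
    moreover have "y u = z" if "\<And>j. \<bar>u $ j\<bar> \<le> R" for u
      using that y(3)[of u] gap[of u] by (simp add: near_def le_max_iff_disj)
    ultimately have "(c ^^ n) y 0 = z" using R[of 1 y n] n by simp
    moreover have "(c ^^ n) x 0 = (c ^^ n) y 0"
      by (rule iterate_local[OF x y(1)]) (metis y(3) near_mono max.cobounded2)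
    ultimately show "(c ^^ n) x 0 = z" by simp
  qed
qed

text \<open>
  Every orbit has the box of radius \<open>R\<close> empty at some time, and this is visible in a finite part of
  the initial configuration. So compactness bounds that time by a constant \<open>k\<close>, and \<open>N\<close> steps
  after it the origin is blank forever.
\<close>

lemma nilpotent_if_dense_and_compact:
  assumes dense: "\<And>x b. x \<in> X \<Longrightarrow> \<exists>y\<in>X. finite_config z y \<and> (\<forall>u. near b u 0 \<longrightarrow> y u = x u)"
    and compact: "\<And>P :: nat \<Rightarrow> ('a, 'd) config \<Rightarrow> bool.
      (\<And>k l x. P k x \<Longrightarrow> k \<le> l \<Longrightarrow> P l x) \<Longrightarrow>
      (\<And>x. x \<in> X \<Longrightarrow> \<exists>k b. \<forall>y\<in>X. (\<forall>u. near b u 0 \<longrightarrow> y u = x u) \<longrightarrow> P k y) \<Longrightarrow>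
      \<exists>k. \<forall>x\<in>X. P k x"
  shows "nilpotent_on z X c"
proof -
  obtain R N where R: "\<And>x n. x \<in> X \<Longrightarrow> (\<And>u. near R u 0 \<Longrightarrow> x u = z) \<Longrightarrow> N \<le> n \<Longrightarrow> (c ^^ n) x 0 = z"
    using empty_box_shields[OF dense] by blast
  define P where "P k x \<longleftrightarrow> (\<exists>j\<le>k. \<forall>u. near R u 0 \<longrightarrow> (c ^^ j) x u = z)" for k x
  have "\<exists>k. \<forall>x\<in>X. P k x"
  proof (rule compact)
    show "P k x \<Longrightarrow> k \<le> l \<Longrightarrow> P l x" for k l x
      unfolding P_def by (meson order_trans)
  next
    fix x assume x: "x \<in> X"
    obtain j where j: "\<And>n w. j \<le> n \<Longrightarrow> w \<in> {u. near R u 0} \<Longrightarrow> (c ^^ n) x w = z"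
      using finite_vanishing[OF x finite_near] by blast
    have "P j y" if y: "y \<in> X" "\<forall>u. near (int j * s + R) u 0 \<longrightarrow> y u = x u" for y
    proof -
      have "(c ^^ j) y u = z" if u: "near R u 0" for u
      proof -
        have "(c ^^ j) y u = (c ^^ j) x u"
          by (rule iterate_local[OF y(1) x]) (use y(2) near_triangle[OF _ u] in blast)
        then show ?thesis using j u by simp
      qed
      then show ?thesis unfolding P_def by blast
    qed
    then show "\<exists>k b. \<forall>y\<in>X. (\<forall>u. near b u 0 \<longrightarrow> y u = x u) \<longrightarrow> P k y" by blast
  qed
  then obtain k where k: "\<And>x. x \<in> X \<Longrightarrow> P k x" by blast
  have "(c ^^ n) x v = z" if n: "k + N \<le> n" and x: "x \<in> X" for n x v
  proof -
    obtain j where j: "j \<le> k" "\<And>u. near R u 0 \<Longrightarrow> (c ^^ j) (shift v x) u = z"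
      using k[OF shift_mem[OF x, of v]] unfolding P_def by blast
    have "(c ^^ (n - j)) ((c ^^ j) (shift v x)) 0 = z"
      by (rule R) (use j n x in \<open>auto simp: iterate_mem shift_mem\<close>)
    moreover have "(c ^^ (n - j)) ((c ^^ j) (shift v x)) = (c ^^ n) (shift v x)"
      using j(1) n funpow_add[of "n - j" j c] by (simp add: fun_eq_iff)
    ultimately show ?thesis using iterate_shift_apply[OF x, of n v 0] by simp
  qed
  then show ?thesis unfolding nilpotent_on_def by blast
qed

end

section \<open>From topology to radii\<close>

lemma topspace_full_shift: "x \<in> topspace (full_shift S) \<longleftrightarrow> (\<forall>u. x u \<in> S)"
  by (auto simp: full_shift_def PiE_def)

lemma openin_cylinder:
  "openin (full_shift S) {x \<in> topspace (full_shift S). \<forall>u. near b u v \<longrightarrow> x u = y u}"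
proof -
  let ?U = "\<lambda>u. if near b u v then S \<inter> {y u} else S"
  have fin: "finite {u. near b u v}"
  proof (rule finite_subset)
    show "{u. near b u v} \<subseteq> (\<lambda>u. u + v) ` {u. near b u 0}"
    proof
      fix u assume "u \<in> {u. near b u v}"
      then show "u \<in> (\<lambda>u. u + v) ` {u. near b u 0}"
        by (intro image_eqI[of _ _ "u - v"]) (auto simp: near_def)
    qed
  qed (simp add: finite_near)
  have "openin (full_shift S) (PiE UNIV ?U)"
    unfolding full_shift_def
    by (rule product_topology_basis) (auto intro: finite_subset[OF _ fin])
  moreover have "PiE UNIV ?U = {x \<in> topspace (full_shift S). \<forall>u. near b u v \<longrightarrow> x u = y u}"
    by (auto simp: topspace_full_shift PiE_iff split: if_splits) metis
  ultimately show ?thesis by simp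
qed

lemma openin_contains_cylinder:
  fixes x :: "('a, 'd::finite) config"
  assumes "openin (full_shift S) U" "x \<in> U"
  obtains b where "\<And>y. y \<in> topspace (full_shift S) \<Longrightarrow> (\<And>u. near b u 0 \<Longrightarrow> y u = x u) \<Longrightarrow> y \<in> U"
proof -
  obtain V where V: "finite {u. V u \<noteq> S}" "x \<in> PiE UNIV V" "PiE UNIV V \<subseteq> U"
    using assms unfolding full_shift_def openin_product_topology_alt by force
  obtain f where f: "\<And>u :: int ^ 'd. near (f u) u 0" using ex_near by metis
  define b where "b = Max (f ` {u. V u \<noteq> S})"
  show thesis
  proof (rule that[of b])
    fix y assume y: "y \<in> topspace (full_shift S)" "\<And>u. near b u 0 \<Longrightarrow> y u = x u"
    have "y u \<in> V u" for u
    proof (cases "V u = S")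
      case True
      then show ?thesis using y(1) by (simp add: topspace_full_shift)
    next
      case False
      then have "f u \<le> b" unfolding b_def using V(1) by simp
      then have "y u = x u" using y(2) f near_mono by blast
      then show ?thesis using V(2) by (simp add: PiE_iff)
    qed
    then show "y \<in> U" using V(3) by (auto simp: PiE_iff)
  qed
qed

text \<open>
  Tychonoff compactness in the form of a principle for properties \<open>P k\<close> that grow with \<open>k\<close>: if
  every point satisfies one of them for a reason visible in a box, then one \<open>k\<close> suffices. It gives
  both the radius of \<open>c\<close> and the uniform bound in the last step of the proof.
\<close>

lemma subshift_compactness:
  fixes P :: "nat \<Rightarrow> ('a, 'd::finite) config \<Rightarrow> bool"
  assumes S: "finite S" and X: "closedin (full_shift S) X"
    and mono: "\<And>k l x. P k x \<Longrightarrow> k \<le> l \<Longrightarrow> P l x"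
    and loc: "\<And>x. x \<in> X \<Longrightarrow> \<exists>k b. \<forall>y\<in>X. (\<forall>u. near b u 0 \<longrightarrow> y u = x u) \<longrightarrow> P k y"
  shows "\<exists>k. \<forall>x\<in>X. P k x"
proof -
  have "compact_space (full_shift S :: ('a, 'd) config topology)"
    using S by (simp add: full_shift_def compact_space_product_topology compact_space_discrete_topology)
  then have comp: "compactin (full_shift S) X"
    using X by (rule closedin_compact_space)
  define \<U> where "\<U> = {U. openin (full_shift S) U \<and> (\<exists>k. \<forall>y\<in>X \<inter> U. P k y)}"
  have "\<exists>U\<in>\<U>. x \<in> U" if x: "x \<in> X" for x
  proof -
    obtain k b where k: "\<forall>y\<in>X. (\<forall>u. near b u 0 \<longrightarrow> y u = x u) \<longrightarrow> P k y"
      using loc[OF x] by blast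
    let ?U = "{y \<in> topspace (full_shift S). \<forall>u. near b u 0 \<longrightarrow> y u = x u}"
    have "?U \<in> \<U>" using openin_cylinder k by (auto simp: \<U>_def)
    moreover have "x \<in> ?U" using x closedin_subset[OF X] by auto
    ultimately show ?thesis by (rule bexI[rotated])
  qed
  then have "X \<subseteq> \<Union>\<U>" by blast
  moreover have "\<forall>U\<in>\<U>. openin (full_shift S) U" by (simp add: \<U>_def)
  ultimately obtain \<F> where \<F>: "finite \<F>" "\<F> \<subseteq> \<U>" "X \<subseteq> \<Union>\<F>"
    using comp unfolding compactin_def by meson
  have "\<forall>U\<in>\<U>. \<exists>k. \<forall>y\<in>X \<inter> U. P k y" by (simp add: \<U>_def)
  then obtain k where "\<forall>U\<in>\<U>. \<forall>y\<in>X \<inter> U. P (k U) y" unfolding bchoice_iff by (rule exE)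
  then have k: "\<And>U y. U \<in> \<U> \<Longrightarrow> y \<in> X \<inter> U \<Longrightarrow> P (k U) y" by blast
  have "P (Max (k ` \<F>)) x" if "x \<in> X" for x
  proof -
    obtain U where U: "U \<in> \<F>" "x \<in> U" using \<F>(3) \<open>x \<in> X\<close> by blast
    then have "P (k U) x" using k \<F>(2) that by blast
    then show ?thesis by (rule mono) (use U \<F>(1) in simp)
  qed
  then show ?thesis by blast
qed

text \<open>The radius covers all finitely many forbidden patterns, each placed at the origin.\<close>

lemma sft_radius:
  fixes X :: "('a, 'd::finite) config set"
  assumes "subshift_of_finite_type S X"
  obtains r where "0 \<le> r"
    and "\<And>x. (\<And>v. \<exists>x'\<in>X. \<forall>u. near r u v \<longrightarrow> x u = x' u) \<Longrightarrow> x \<in> X"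
proof -
  obtain F where F: "finite F" "\<And>p. p \<in> F \<Longrightarrow> finite_pattern S p"
    and X: "X = {x \<in> topspace (full_shift S). \<forall>p\<in>F. \<not> contains_translate x p}"
    using assms unfolding subshift_of_finite_type_def by blast
  obtain f where f: "\<And>u :: int ^ 'd. near (f u) u 0" using ex_near by metis
  define A where "A = insert 0 (f ` (\<Union>p\<in>F. dom p))"
  define r where "r = Max A"
  have finA: "finite A" using F by (simp add: A_def finite_pattern_def)
  have r0: "0 \<le> r" unfolding r_def using finA by (intro Max_ge) (simp_all add: A_def)
  have r: "near r u 0" if "u \<in> dom p" "p \<in> F" for u p
  proof -
    have "f u \<le> r" unfolding r_def using finA that by (intro Max_ge) (auto simp: A_def)
    then show ?thesis using f near_mono by blast
  qed
  show thesis
  proof (rule that[OF r0])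
    fix x assume loc: "\<And>v. \<exists>x'\<in>X. \<forall>u. near r u v \<longrightarrow> x u = x' u"
    have "x v \<in> S" for v
    proof -
      obtain x' where "x' \<in> X" "\<forall>u. near r u v \<longrightarrow> x u = x' u" using loc by blast
      moreover have "near r v v" using r0 by (simp add: near_def)
      ultimately show ?thesis by (simp add: X topspace_full_shift)
    qed
    moreover have "\<not> contains_translate x p" if p: "p \<in> F" for p
    proof
      assume "contains_translate x p"
      then obtain v where v: "\<forall>u\<in>dom p. p u = Some (x (u + v))"
        by (auto simp: contains_translate_def)
      obtain x' where x': "x' \<in> X" "\<forall>u. near r u v \<longrightarrow> x u = x' u" using loc by blast
      have "p u = Some (x' (u + v))" if "u \<in> dom p" for u
      proof -
        have "near r (u + v) v" using r[OF that p] by (simp add: near_def)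
        then show ?thesis using x'(2) v that by simp
      qed
      then have "contains_translate x' p" by (auto simp: contains_translate_def)
      then show False using x'(1) p by (simp add: X)
    qed
    ultimately show "x \<in> X" by (simp add: X topspace_full_shift)
  qed
qed

text \<open>
  One half of the Curtis--Hedlund--Lyndon theorem: continuity gives a radius for the symbol at
  the origin that depends on the configuration, compactness a common one, and shifting carries it
  to all cells.
\<close>

lemma cellular_automaton_radius:
  fixes X :: "('a, 'd::finite) config set"
  assumes S: "finite S" and X: "subshift S X" and c: "cellular_automaton S X c"
  obtains r where "\<And>x y v. x \<in> X \<Longrightarrow> y \<in> X \<Longrightarrow> (\<And>u. near r u v \<Longrightarrow> x u = y u) \<Longrightarrow> c x v = c y v"
proof -
  have closed: "closedin (full_shift S) X" using X by (simp add: subshift_def)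
  have sub: "X \<subseteq> topspace (full_shift S)" using closed by (rule closedin_subset)
  have cont: "continuous_map (subtopology (full_shift S) X) (subtopology (full_shift S) X) c"
    and comm: "\<And>v x. x \<in> X \<Longrightarrow> c (shift v x) = shift v (c x)"
    using c by (auto simp: cellular_automaton_def)
  have top: "topspace (subtopology (full_shift S) X) = X" using sub by auto
  define P where "P k x \<longleftrightarrow> (\<forall>y\<in>X. (\<forall>u. near (int k) u 0 \<longrightarrow> y u = x u) \<longrightarrow> c y 0 = c x 0)"
    for k x
  have "\<exists>k. \<forall>x\<in>X. P k x"
  proof (rule subshift_compactness[OF S closed])
    show "P k x \<Longrightarrow> k \<le> l \<Longrightarrow> P l x" for k l x
      unfolding P_def using near_mono by (metis of_nat_mono)
  next
    fix x assume x: "x \<in> X"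
    let ?U = "{y \<in> topspace (full_shift S). \<forall>u. near 0 u 0 \<longrightarrow> y u = c x u}"
    have "openin (subtopology (full_shift S) X) (X \<inter> ?U)"
      using openin_cylinder by (rule openin_subtopology_Int2)
    then have "openin (subtopology (full_shift S) X) {y \<in> X. c y \<in> X \<inter> ?U}"
      using cont unfolding continuous_map_def top by blast
    then obtain V where V: "openin (full_shift S) V" "{y \<in> X. c y \<in> X \<inter> ?U} = V \<inter> X"
      unfolding openin_subtopology by blast
    have "c x \<in> X" using cont x unfolding continuous_map_def top by blast
    then have "x \<in> V" using V(2) x sub by blast
    then obtain b where b: "\<And>y. y \<in> topspace (full_shift S) \<Longrightarrow> (\<And>u. near b u 0 \<Longrightarrow> y u = x u) \<Longrightarrow> y \<in> V"
      using openin_contains_cylinder[OF V(1)] by blast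
    have eq: "c y 0 = c x 0" if "y \<in> X" "\<forall>u. near b u 0 \<longrightarrow> y u = x u" for y
    proof -
      have "y \<in> V \<inter> X" using b that sub by blast
      then have "c y \<in> ?U" using V(2) by blast
      then show ?thesis by (simp add: near_def)
    qed
    have "P (nat b) y" if "y \<in> X" "\<forall>u. near (int (nat b)) u 0 \<longrightarrow> y u = x u" for y
      unfolding P_def
    proof (intro ballI impI)
      fix y' assume y': "y' \<in> X" "\<forall>u. near (int (nat b)) u 0 \<longrightarrow> y' u = y u"
      have le: "near b u 0 \<Longrightarrow> near (int (nat b)) u 0" for u :: "int ^ 'd"
        by (erule near_mono) simp
      have "c y 0 = c x 0" using eq that le by blast
      moreover have "\<forall>u. near b u 0 \<longrightarrow> y' u = x u" using y'(2) that(2) le by simp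
      then have "c y' 0 = c x 0" using eq y'(1) by blast
      ultimately show "c y' 0 = c y 0" by simp
    qed
    then show "\<exists>k b. \<forall>y\<in>X. (\<forall>u. near b u 0 \<longrightarrow> y u = x u) \<longrightarrow> P k y" by blast
  qed
  then obtain k where k: "\<And>x. x \<in> X \<Longrightarrow> P k x" by blast
  show thesis
  proof (rule that[of "int k"])
    fix x y v assume x: "x \<in> X" and y: "y \<in> X" and eq: "\<And>u. near (int k) u v \<Longrightarrow> x u = y u"
    have inX: "shift v x \<in> X" "shift v y \<in> X" using X x y by (auto simp: subshift_def)
    have "shift v y u = shift v x u" if "near (int k) u 0" for u
    proof -
      have "near (int k) (u + v) v" using that by (simp add: near_def)
      then show ?thesis using eq by (simp add: shift_def)
    qed
    then have "c (shift v y) 0 = c (shift v x) 0" using k[OF inX(1)] inX(2) unfolding P_def by blast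
    then show "c x v = c y v" by (simp add: comm x y) (simp add: shift_def)
  qed
qed

theorem theorem4:
  fixes S :: "'a set" and z :: 'a
    and X :: "('a, 'd::finite) config set"
    and c :: "('a, 'd) config \<Rightarrow> ('a, 'd) config"
  assumes "finite S" and "z \<in> S"
    and "subshift_of_finite_type S X"
    and "subtopology (full_shift S) X closure_of {x \<in> X. finite_config z x} = X"
    and "cellular_automaton S X c"
    and "asymptotically_nilpotent_on z X c"
  shows "nilpotent_on z X c"
proof (cases "X = {}")
  case True
  then show ?thesis by (simp add: nilpotent_on_def)
next
  case False
  have sub: "subshift S X" using assms(3) by (simp add: subshift_of_finite_type_def)
  then have closed: "closedin (full_shift S) X" by (simp add: subshift_def)
  have subset: "X \<subseteq> topspace (full_shift S)" using closed by (rule closedin_subset)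
  have top: "topspace (subtopology (full_shift S) X) = X" using subset by auto
  obtain r where r: "0 \<le> r"
    "\<And>x. (\<And>v. \<exists>x'\<in>X. \<forall>u. near r u v \<longrightarrow> x u = x' u) \<Longrightarrow> x \<in> X"
    using sft_radius[OF assms(3)] by blast
  obtain r' where r':
    "\<And>x y v. x \<in> X \<Longrightarrow> y \<in> X \<Longrightarrow> (\<And>u. near r' u v \<Longrightarrow> x u = y u) \<Longrightarrow> c x v = c y v"
    using cellular_automaton_radius[OF assms(1) sub assms(5)] by blast
  have "local_dynamics z X c (max r r')"
  proof
    show "0 \<le> max r r'" using r(1) by simp
    show "X \<noteq> {}" by (rule False)
    show "x \<in> X" if "\<And>v. \<exists>x'\<in>X. \<forall>u. near (max r r') u v \<longrightarrow> x u = x' u" for x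
      by (rule r(2)) (meson that near_mono max.cobounded1)
    show "shift v x \<in> X" if "x \<in> X" for x v using sub that by (simp add: subshift_def)
    show "c x \<in> X" if "x \<in> X" for x
      using assms(5) that unfolding cellular_automaton_def continuous_map_def top by blast
    show "c x v = c x' v" if "x \<in> X" "x' \<in> X" "\<And>u. near (max r r') u v \<Longrightarrow> x u = x' u" for x x' v
      by (rule r'[OF that(1,2)]) (meson that(3) near_mono max.cobounded2)
    show "c (shift v x) = shift v (c x)" if "x \<in> X" for x v
      using assms(5) that by (simp add: cellular_automaton_def)
    show "\<exists>m. \<forall>n\<ge>m. (c ^^ n) x v = z" if "x \<in> X" for x v
      using assms(6) that by (simp add: asymptotically_nilpotent_on_def)
  qed
  then show ?thesis
  proof (rule local_dynamics.nilpotent_if_dense_and_compact)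
    fix x b assume x: "x \<in> X"
    let ?U = "{y \<in> topspace (full_shift S). \<forall>u. near b u 0 \<longrightarrow> y u = x u}"
    have "openin (subtopology (full_shift S) X) (X \<inter> ?U)"
      using openin_cylinder by (rule openin_subtopology_Int2)
    moreover have "x \<in> X \<inter> ?U" using x subset by auto
    moreover have "x \<in> subtopology (full_shift S) X closure_of {x \<in> X. finite_config z x}"
      by (simp only: assms(4) x)
    then have "\<forall>T. x \<in> T \<and> openin (subtopology (full_shift S) X) T \<longrightarrow>
        (\<exists>y. y \<in> {x \<in> X. finite_config z x} \<and> y \<in> T)"
      unfolding in_closure_of by (rule conjunct2)
    ultimately obtain y where "y \<in> {x \<in> X. finite_config z x}" "y \<in> X \<inter> ?U"
      by meson
    then show "\<exists>y\<in>X. finite_config z y \<and> (\<forall>u. near b u 0 \<longrightarrow> y u = x u)" by auto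
  next
    fix P :: "nat \<Rightarrow> ('a, 'd) config \<Rightarrow> bool"
    assume "\<And>k l x. P k x \<Longrightarrow> k \<le> l \<Longrightarrow> P l x"
      "\<And>x. x \<in> X \<Longrightarrow> \<exists>k b. \<forall>y\<in>X. (\<forall>u. near b u 0 \<longrightarrow> y u = x u) \<longrightarrow> P k y"
    then show "\<exists>k. \<forall>x\<in>X. P k x" by (rule subshift_compactness[OF assms(1) closed])
  qed
qed

end
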